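(* Let $X=(X_t)_{t\ge0}$ be a symmetric Lévy process in $\mathbb{R}^d$ with infinite Lévy measure having a strictly positive density (see context), and let $V$ be an $X$-Kato decomposable potential with $V(x)\to0$ as $|x|\to\infty$. Suppose that a ground state of the non-local Schrödinger operator $H$ at the eigenvalue $\lambda_0<0$ exists. For $r>0$ denote by $\mu_r>0$ the principal eigenvalue of the semigroup of the process $X$ killed on exiting the ball $B(0,r)$. Then for every $r>0$ $$\lambda_0\le\sup_{|y|\le2r}V_+(y)-\inf_{|y|\le2r}V_-(y)+\mu_r.$$
   Context: Process. $X=(X_t)_{t\ge0}$ is a symmetric Lévy process with values in $\mathbb{R}^d$, $d\ge1$; $\mathbf{P}^x,\mathbf{E}^x$ are the law and expectation for the process started at $x$. It is determined by $\mathbf{E}^0[e^{i\xi\cdot X_t}]=e^{-t\psi(\xi)}$ with $\psi(\xi)=A\xi\cdot\xi+\int(1-\cos(\xi\cdot z))\,\nu(dz)$, where $A$ is a symmetric non-negative definite matrix and $\nu$ is a symmetric Lévy measure with $\nu(\mathbb{R}^d\setminus\{0\})=\infty$ and $\nu(dx)=\nu(x)dx$, $\nu(x)>0$. $B(0,r)$ is the open ball and $\tau_D=\inf\{t\ge0:X_t\notin D\}$. The semigroup of the process killed on exiting $B(0,r)$ is $P_t^rf(x)=\mathbf{E}^x[\tau_{B(0,r)}>t;f(X_t)]$ on $L^2(B(0,r))$; its principal eigenvalue $\mu_r$ is the lowest eigenvalue, i.e. $e^{-\mu_rt}$ is the largest eigenvalue of $P^r_t$. Potentials. $V\in\mathcal{K}^X$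 if $\lim_{t\downarrow0}\sup_{x}\mathbf{E}^x[\int_0^t|V(X_s)|ds]=0$; $V\in\mathcal{K}^X_{\rm loc}$ if $V\mathbf 1_B\in\mathcal{K}^X$ for all compact $B$. A Borel $V:\mathbb{R}^d\to\mathbb{R}$ is $X$-Kato decomposable if $V_-\in\mathcal{K}^X$ and $V_+\in\mathcal{K}^X_{\rm loc}$, where $V=V_+-V_-$ with $V_+,V_-\geq 0$ the positive and negative parts. Operator. $T_tf(x)=\mathbf{E}^x[e^{-\int_0^tV(X_s)ds}f(X_t)]$ defines a strongly continuous symmetric semigroup on $L^2(\mathbb{R}^d)$, and $H$ is the self-adjoint operator, bounded from below, with $e^{-tH}=T_t$. A ground state exists if $\lambda_0=\inf\mathrm{Spec}\,H$ is an isolated eigenvalue of $H$. *)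

theory Defs
  imports "HOL-Probability.Probability"
begin

section \<open>Symmetric Levy processes\<close>

text \<open>The time parameter is a real number; only the values for nonnegative times matter.
  The process \<open>X\<close> starts at the origin; the process started at \<open>x\<close> is \<open>x + X\<close>.\<close>

definition cadlag :: "(real \<Rightarrow> 'a::topological_space) \<Rightarrow> bool" where
  "cadlag w \<longleftrightarrow>
     (\<forall>t\<ge>0. continuous (at_right t) w) \<and> (\<forall>t>0. \<exists>l. (w \<longlongrightarrow> l) (at_left t))"

definition levy_process :: "'w measure \<Rightarrow> (real \<Rightarrow> 'w \<Rightarrow> 'a::euclidean_space) \<Rightarrow> bool" where
  "levy_process M X \<longleftrightarrow>
     prob_space M \<and>
     (\<forall>t\<ge>0. X t \<in> borel_measurable M) \<and>
     (AE \<omega> in M. X 0 \<omega> = 0) \<and>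
     (\<forall>(n::nat) t. 0 \<le> t 0 \<and> (\<forall>i<n. t i \<le> t (Suc i)) \<longrightarrow>
        prob_space.indep_vars M (\<lambda>_. borel) (\<lambda>i \<omega>. X (t (Suc i)) \<omega> - X (t i) \<omega>) {..<n}) \<and>
     (\<forall>s\<ge>0. \<forall>t\<ge>0. distr M borel (\<lambda>\<omega>. X (s + t) \<omega> - X s \<omega>) = distr M borel (X t)) \<and>
     (AE \<omega> in M. cadlag (\<lambda>t. X t \<omega>))"

definition symmetric_levy_process ::
    "'w measure \<Rightarrow> (real \<Rightarrow> 'w \<Rightarrow> 'a::euclidean_space) \<Rightarrow> bool" where
  "symmetric_levy_process M X \<longleftrightarrow>
     levy_process M X \<and> (\<forall>t\<ge>0. distr M borel (\<lambda>\<omega>. - X t \<omega>) = distr M borel (X t))"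

definition symmetric_levy_measure :: "'a::euclidean_space measure \<Rightarrow> bool" where
  "symmetric_levy_measure N \<longleftrightarrow>
     sets N = sets borel \<and> emeasure N {0} = 0 \<and>
     (\<integral>\<^sup>+z. ennreal (min 1 ((norm z)\<^sup>2)) \<partial>N) < \<infinity> \<and>
     distr N borel uminus = N"

definition levy_exponent ::
    "real ^ 'n ^ 'n \<Rightarrow> (real ^ 'n) measure \<Rightarrow> real ^ 'n \<Rightarrow> real" where
  "levy_exponent A N \<xi> = (A *v \<xi>) \<bullet> \<xi> + (\<integral>z. 1 - cos (\<xi> \<bullet> z) \<partial>N)"

definition has_exponent ::
    "'w measure \<Rightarrow> (real \<Rightarrow> 'w \<Rightarrow> 'a::euclidean_space) \<Rightarrow> ('a \<Rightarrow> real) \<Rightarrow> bool" where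
  "has_exponent M X \<psi> \<longleftrightarrow>
     (\<forall>t\<ge>0. \<forall>\<xi>. (\<integral>\<omega>. iexp (\<xi> \<bullet> X t \<omega>) \<partial>M) = of_real (exp (- t * \<psi> \<xi>)))"

text \<open>Expectation of a path functional for the process started at \<open>x\<close>. It is taken in the
  completed probability space: exit times of right-continuous processes are in general only
  measurable with respect to the completion, and paths are assumed cadlag only almost surely.\<close>

definition path_expectation ::
    "'w measure \<Rightarrow> (real \<Rightarrow> 'w \<Rightarrow> 'a::euclidean_space) \<Rightarrow> 'a \<Rightarrow> ((real \<Rightarrow> 'a) \<Rightarrow> complex) \<Rightarrow> complex"
  where "path_expectation M X x F = (\<integral>\<omega>. F (\<lambda>t. x + X t \<omega>) \<partial>completion M)"

definition path_nn_expectation ::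
    "'w measure \<Rightarrow> (real \<Rightarrow> 'w \<Rightarrow> 'a::euclidean_space) \<Rightarrow> 'a \<Rightarrow> ((real \<Rightarrow> 'a) \<Rightarrow> ennreal) \<Rightarrow> ennreal"
  where "path_nn_expectation M X x F = (\<integral>\<^sup>+\<omega>. F (\<lambda>t. x + X t \<omega>) \<partial>completion M)"

definition exit_time :: "'a set \<Rightarrow> (real \<Rightarrow> 'a) \<Rightarrow> ereal" where
  "exit_time D w = Inf (ereal ` {t. 0 \<le> t \<and> w t \<notin> D})"


section \<open>Kato classes\<close>

definition pos_part :: "('a \<Rightarrow> real) \<Rightarrow> 'a \<Rightarrow> real" where
  "pos_part V x = max 0 (V x)"

definition neg_part :: "('a \<Rightarrow> real) \<Rightarrow> 'a \<Rightarrow> real" where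
  "neg_part V x = max 0 (- V x)"

definition kato_class ::
    "'w measure \<Rightarrow> (real \<Rightarrow> 'w \<Rightarrow> 'a::euclidean_space) \<Rightarrow> ('a \<Rightarrow> real) set" where
  "kato_class M X = {V. V \<in> borel_measurable borel \<and>
     ((\<lambda>t. SUP x. path_nn_expectation M X x
        (\<lambda>w. \<integral>\<^sup>+s\<in>{0..t}. ennreal \<bar>V (w s)\<bar> \<partial>lborel)) \<longlongrightarrow> 0) (at_right 0)}"

definition local_kato_class ::
    "'w measure \<Rightarrow> (real \<Rightarrow> 'w \<Rightarrow> 'a::euclidean_space) \<Rightarrow> ('a \<Rightarrow> real) set" where
  "local_kato_class M X = {V. V \<in> borel_measurable borel \<and>
     (\<forall>B. compact B \<longrightarrow> (\<lambda>x. V x * indicator B x) \<in> kato_class M X)}"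

definition kato_decomposable ::
    "'w measure \<Rightarrow> (real \<Rightarrow> 'w \<Rightarrow> 'a::euclidean_space) \<Rightarrow> ('a \<Rightarrow> real) \<Rightarrow> bool" where
  "kato_decomposable M X V \<longleftrightarrow>
     V \<in> borel_measurable borel \<and>
     neg_part V \<in> kato_class M X \<and> pos_part V \<in> local_kato_class M X"


section \<open>Unbounded operators on complex $L^2$ spaces\<close>

text \<open>Elements of $L^2$ are represented by functions, equality in $L^2$ being equality almost
  everywhere. An operator is represented by its graph, as a relation between such functions; the
  graph contains, with a pair, all pairs of other representatives.\<close>

definition L2 :: "'b measure \<Rightarrow> ('b \<Rightarrow> complex) set" where
  "L2 N = {f. f \<in> borel_measurable N \<and> integrable N (\<lambda>x. (cmod (f x))\<^sup>2)}"

definition L2_inner :: "'b measure \<Rightarrow> ('b \<Rightarrow> complex) \<Rightarrow> ('b \<Rightarrow> complex) \<Rightarrow> complex" where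
  "L2_inner N f g = (\<integral>x. f x * cnj (g x) \<partial>N)"

definition L2_norm :: "'b measure \<Rightarrow> ('b \<Rightarrow> complex) \<Rightarrow> real" where
  "L2_norm N f = sqrt (\<integral>x. (cmod (f x))\<^sup>2 \<partial>N)"

definition operator_graph ::
    "'b measure \<Rightarrow> (('b \<Rightarrow> complex) \<Rightarrow> 'b \<Rightarrow> complex) \<Rightarrow> ('b \<Rightarrow> complex) rel" where
  "operator_graph N P = {(f, g). f \<in> L2 N \<and> g \<in> L2 N \<and> (AE x in N. g x = P f x)}"

definition densely_defined :: "'b measure \<Rightarrow> ('b \<Rightarrow> complex) rel \<Rightarrow> bool" where
  "densely_defined N H \<longleftrightarrow>
     (\<forall>u\<in>L2 N. \<forall>\<epsilon>>0. \<exists>(f, g)\<in>H. L2_norm N (\<lambda>x. f x - u x) < \<epsilon>)"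

definition adjoint_graph :: "'b measure \<Rightarrow> ('b \<Rightarrow> complex) rel \<Rightarrow> ('b \<Rightarrow> complex) rel" where
  "adjoint_graph N H =
     {(u, v). u \<in> L2 N \<and> v \<in> L2 N \<and> (\<forall>(f, g)\<in>H. L2_inner N g u = L2_inner N f v)}"

text \<open>Linearity and single-valuedness (up to null sets) need not be required separately: the
  adjoint graph of a densely defined graph always has these properties.\<close>

definition self_adjoint :: "'b measure \<Rightarrow> ('b \<Rightarrow> complex) rel \<Rightarrow> bool" where
  "self_adjoint N H \<longleftrightarrow> densely_defined N H \<and> adjoint_graph N H = H"

definition bounded_from_below :: "'b measure \<Rightarrow> ('b \<Rightarrow> complex) rel \<Rightarrow> bool" where
  "bounded_from_below N H \<longleftrightarrow>
     (\<exists>c. \<forall>(f, g)\<in>H. c * (L2_norm N f)\<^sup>2 \<le> Re (L2_inner N g f))"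

definition eigenvalue :: "'b measure \<Rightarrow> ('b \<Rightarrow> complex) rel \<Rightarrow> complex \<Rightarrow> bool" where
  "eigenvalue N H z \<longleftrightarrow>
     (\<exists>(f, g)\<in>H. \<not> (AE x in N. f x = 0) \<and> (AE x in N. g x = z * f x))"

text \<open>The resolvent set: $H - z$ maps its domain bijectively onto $L^2$, with bounded inverse.
  The second conjunct gives both injectivity and boundedness of the inverse.\<close>

definition resolvent_set :: "'b measure \<Rightarrow> ('b \<Rightarrow> complex) rel \<Rightarrow> complex set" where
  "resolvent_set N H = {z.
     (\<forall>h\<in>L2 N. \<exists>(f, g)\<in>H. AE x in N. g x - z * f x = h x) \<and>
     (\<exists>C. \<forall>(f, g)\<in>H. L2_norm N f \<le> C * L2_norm N (\<lambda>x. g x - z * f x))}"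

definition spectrum :: "'b measure \<Rightarrow> ('b \<Rightarrow> complex) rel \<Rightarrow> complex set" where
  "spectrum N H = - resolvent_set N H"

text \<open>For self-adjoint operators the spectrum is contained in the real axis; taking real parts
  only converts its elements to type \<open>real\<close>.\<close>

definition ground_state_exists_at :: "'b measure \<Rightarrow> ('b \<Rightarrow> complex) rel \<Rightarrow> real \<Rightarrow> bool" where
  "ground_state_exists_at N H E0 \<longleftrightarrow>
     E0 = Inf (Re ` spectrum N H) \<and>
     eigenvalue N H (of_real E0) \<and> of_real E0 isolated_in spectrum N H"

definition strongly_continuous_semigroup ::
    "'b measure \<Rightarrow> (real \<Rightarrow> ('b \<Rightarrow> complex) \<Rightarrow> 'b \<Rightarrow> complex) \<Rightarrow> bool" where
  "strongly_continuous_semigroup N T \<longleftrightarrow>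
     (\<forall>t\<ge>0.
        (\<forall>f\<in>L2 N. T t f \<in> L2 N) \<and>
        (\<forall>f\<in>L2 N. \<forall>g\<in>L2 N. AE x in N. T t (\<lambda>y. f y + g y) x = T t f x + T t g x) \<and>
        (\<forall>c. \<forall>f\<in>L2 N. AE x in N. T t (\<lambda>y. c * f y) x = c * T t f x) \<and>
        (\<exists>C. \<forall>f\<in>L2 N. L2_norm N (T t f) \<le> C * L2_norm N f)) \<and>
     (\<forall>f\<in>L2 N. AE x in N. T 0 f x = f x) \<and>
     (\<forall>s\<ge>0. \<forall>t\<ge>0. \<forall>f\<in>L2 N. AE x in N. T (s + t) f x = T s (T t f) x) \<and>
     (\<forall>f\<in>L2 N. ((\<lambda>t. L2_norm N (\<lambda>x. T t f x - f x)) \<longlongrightarrow> 0) (at_right 0))"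

definition generator ::
    "'b measure \<Rightarrow> (real \<Rightarrow> ('b \<Rightarrow> complex) \<Rightarrow> 'b \<Rightarrow> complex) \<Rightarrow> ('b \<Rightarrow> complex) rel" where
  "generator N T = {(f, g). f \<in> L2 N \<and> g \<in> L2 N \<and>
     ((\<lambda>t. L2_norm N (\<lambda>x. (T t f x - f x) / of_real t - g x)) \<longlongrightarrow> 0) (at_right 0)}"

text \<open>$T_t = e^{-tH}$ for all $t \ge 0$: the exponential denotes the strongly continuous semigroup
  with infinitesimal generator $-H$.\<close>

definition is_exp_semigroup ::
    "'b measure \<Rightarrow> (real \<Rightarrow> ('b \<Rightarrow> complex) \<Rightarrow> 'b \<Rightarrow> complex) \<Rightarrow> ('b \<Rightarrow> complex) rel \<Rightarrow> bool"
  where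
  "is_exp_semigroup N T H \<longleftrightarrow>
     strongly_continuous_semigroup N T \<and>
     generator N T = (\<lambda>(f, g). (f, \<lambda>x. - g x)) ` H"


section \<open>Feynman-Kac and killed semigroups\<close>

definition feynman_kac ::
    "'w measure \<Rightarrow> (real \<Rightarrow> 'w \<Rightarrow> 'a::euclidean_space) \<Rightarrow> ('a \<Rightarrow> real) \<Rightarrow>
     real \<Rightarrow> ('a \<Rightarrow> complex) \<Rightarrow> 'a \<Rightarrow> complex" where
  "feynman_kac M X V t f x =
     path_expectation M X x (\<lambda>w. of_real (exp (- (LBINT s:{0..t}. V (w s)))) * f (w t))"

definition schroedinger_operator ::
    "'w measure \<Rightarrow> (real \<Rightarrow> 'w \<Rightarrow> 'a::euclidean_space) \<Rightarrow> ('a \<Rightarrow> real) \<Rightarrow>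
     ('a \<Rightarrow> complex) rel \<Rightarrow> bool" where
  "schroedinger_operator M X V H \<longleftrightarrow>
     self_adjoint lborel H \<and> bounded_from_below lborel H \<and>
     is_exp_semigroup lborel (feynman_kac M X V) H"

definition killed_semigroup ::
    "'w measure \<Rightarrow> (real \<Rightarrow> 'w \<Rightarrow> 'a::euclidean_space) \<Rightarrow> 'a set \<Rightarrow>
     real \<Rightarrow> ('a \<Rightarrow> complex) \<Rightarrow> 'a \<Rightarrow> complex" where
  "killed_semigroup M X D t f x =
     path_expectation M X x (\<lambda>w. if ereal t < exit_time D w then f (w t) else 0)"

definition principal_eigenvalue ::
    "'w measure \<Rightarrow> (real \<Rightarrow> 'w \<Rightarrow> 'a::euclidean_space) \<Rightarrow> 'a set \<Rightarrow> real \<Rightarrow> bool" where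
  "principal_eigenvalue M X D \<mu> \<longleftrightarrow>
     (\<forall>t>0. let N = restrict_space lborel D; P = operator_graph N (killed_semigroup M X D t) in
        eigenvalue N P (of_real (exp (- \<mu> * t))) \<and>
        (\<forall>c::real. eigenvalue N P (of_real c) \<longrightarrow> c \<le> exp (- \<mu> * t)))"

end

theory Submission
  imports Defs
begin

text \<open>Let \<open>f\<close> be a principal eigenfunction of the semigroup killed on exiting \<open>D = B(0, r)\<close> and put
  \<open>\<Phi> = |f| 1\<^sub>D\<close>. If \<open>V \<le> K\<close> on \<open>D\<close>, then \<open>T\<^sub>t \<Phi> \<ge> exp (- (K + \<mu>) t) \<Phi>\<close> almost everywhere on \<open>D\<close>,
  because on \<open>{t < \<tau>\<^sub>D}\<close> the Feynman-Kac weight is at least \<open>exp (- K t)\<close>. Pairing with \<open>\<Phi>\<close> and using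
  \<open>\<parallel>T\<^sub>t\<parallel> \<le> exp (- \<lambda>\<^sub>0 t)\<close> gives \<open>\<lambda>\<^sub>0 \<le> K + \<mu>\<close>; a single small \<open>t > 0\<close> suffices. The norm bound comes from
  \<open>H \<ge> \<lambda>\<^sub>0\<close>: the infimum of the numerical range of \<open>H\<close> lies in the spectrum, and the spectrum is
  bounded below.\<close>

section \<open>The Hilbert space of square-integrable functions\<close>

text \<open>No spectral theorem enters. Complex L2 is treated as a real Hilbert space on which
  multiplication by the imaginary unit survives as a skew operator, so that a non-real spectral
  parameter becomes a real one plus a skew term. Non-real points matter because \<open>E0\<close> is
  an infimum of real parts over the whole of \<open>spectrum\<close>, and such an infimum is
  informative only once the set is known to be bounded below. The norm bound on the semigroup then
  comes from an energy estimate on the domain of \<open>H\<close>, extended by density. The time has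
  to be small because the Kato condition controls the path integral of the negative part of
  \<open>V\<close> for small times; as both exponents in the final comparison are linear in the
  time, one value determines the inequality. A recurring obstacle is that Bochner integrals default
  to 0: neither the path integral of \<open>V\<close> nor the Feynman-Kac expectation can be
  compared with anything before its integrand is shown to be integrable.\<close>

lemma borel_measurable_cnj [measurable]: "cnj \<in> borel_measurable borel"
  by (intro borel_measurable_continuous_onI continuous_intros)

lemma L2_measurable: "f \<in> L2 N \<Longrightarrow> f \<in> borel_measurable N"
  by (simp add: L2_def)

lemma integrable_L2_mult:
  assumes "f \<in> L2 N" "g \<in> L2 N"
  shows "integrable N (\<lambda>x. f x * cnj (g x))"
proof (rule Bochner_Integration.integrable_bound)
  show "integrable N (\<lambda>x. (cmod (f x))\<^sup>2 + (cmod (g x))\<^sup>2)"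
    using assms by (simp add: L2_def)
  have "cmod (f x) * cmod (g x) \<le> (cmod (f x))\<^sup>2 + (cmod (g x))\<^sup>2" for x
    using sum_squares_bound[of "cmod (f x)" "cmod (g x)"]
      mult_nonneg_nonneg[OF norm_ge_zero[of "f x"] norm_ge_zero[of "g x"]] by linarith
  then show "AE x in N. norm (f x * cnj (g x)) \<le> norm ((cmod (f x))\<^sup>2 + (cmod (g x))\<^sup>2)"
    by (simp add: norm_mult)
qed (use assms in \<open>auto dest!: L2_measurable\<close>)

lemma L2_add:
  assumes "f \<in> L2 N" "g \<in> L2 N"
  shows "(\<lambda>x. f x + g x) \<in> L2 N"
proof -
  have "integrable N (\<lambda>x. (cmod (f x + g x))\<^sup>2)"
  proof (rule Bochner_Integration.integrable_bound)
    show "integrable N (\<lambda>x. 2 * (cmod (f x))\<^sup>2 + 2 * (cmod (g x))\<^sup>2)"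
      using assms by (simp add: L2_def)
    have "(cmod (f x + g x))\<^sup>2 \<le> 2 * (cmod (f x))\<^sup>2 + 2 * (cmod (g x))\<^sup>2" for x
    proof -
      have "(cmod (f x + g x))\<^sup>2 \<le> (cmod (f x) + cmod (g x))\<^sup>2"
        by (intro power_mono norm_triangle_ineq) auto
      then show ?thesis
        using sum_squares_bound[of "cmod (f x)" "cmod (g x)"] by (simp add: power2_sum)
    qed
    then show "AE x in N. norm ((cmod (f x + g x))\<^sup>2)
        \<le> norm (2 * (cmod (f x))\<^sup>2 + 2 * (cmod (g x))\<^sup>2)" by simp
  qed (use assms in \<open>auto dest!: L2_measurable\<close>)
  then show ?thesis using assms by (auto simp: L2_def)
qed

lemma L2_cmult: "f \<in> L2 N \<Longrightarrow> (\<lambda>x. c * f x) \<in> L2 N"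
  by (auto simp: L2_def norm_mult power_mult_distrib)

lemma L2_zero [simp]: "(\<lambda>x. 0) \<in> L2 N"
  by (auto simp: L2_def)

lemma L2_uminus: "f \<in> L2 N \<Longrightarrow> (\<lambda>x. - f x) \<in> L2 N"
  by (auto simp: L2_def)

lemma L2_diff: "f \<in> L2 N \<Longrightarrow> g \<in> L2 N \<Longrightarrow> (\<lambda>x. f x - g x) \<in> L2 N"
  using L2_add[OF _ L2_uminus, of f N g] by simp

lemma L2_inner_self: "L2_inner N f f = of_real (\<integral>x. (cmod (f x))\<^sup>2 \<partial>N)"
  by (simp add: L2_inner_def complex_norm_square[symmetric] flip: integral_complex_of_real)

lemma L2_inner_cong_AE:
  assumes "f \<in> L2 N" "g \<in> L2 N" "f' \<in> L2 N" "g' \<in> L2 N"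
    "AE x in N. f x = f' x" "AE x in N. g x = g' x"
  shows "L2_inner N f g = L2_inner N f' g'"
  unfolding L2_inner_def
  by (rule integral_cong_AE) (use assms in \<open>auto dest!: L2_measurable\<close>)

\<comment> \<open>Square-integrable classes as a real Hilbert space\<close>
quotient_type (overloaded) 'a l2 = "'a::euclidean_space \<Rightarrow> complex" /
  partial: "\<lambda>f g. f \<in> L2 lborel \<and> g \<in> L2 lborel \<and> (AE x in lborel. f x = g x)"
proof (rule part_equivpI)
  show "\<exists>f. f \<in> L2 lborel \<and> f \<in> L2 lborel \<and> (AE x in lborel. f x = (f x :: complex))"
    by (rule exI[of _ "\<lambda>_. 0"]) simp
  show "symp (\<lambda>f g :: 'a \<Rightarrow> complex. f \<in> L2 lborel \<and> g \<in> L2 lborel \<and> (AE x in lborel. f x = g x))"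
    by (rule sympI) auto
  show "transp (\<lambda>f g :: 'a \<Rightarrow> complex. f \<in> L2 lborel \<and> g \<in> L2 lborel \<and> (AE x in lborel. f x = g x))"
    by (rule transpI) auto
qed

instantiation l2 :: (euclidean_space) real_vector
begin

lift_definition zero_l2 :: "'a l2" is "\<lambda>_. 0" by simp
lift_definition plus_l2 :: "'a l2 \<Rightarrow> 'a l2 \<Rightarrow> 'a l2" is "\<lambda>f g x. f x + g x"
  by (auto intro: L2_add)
lift_definition minus_l2 :: "'a l2 \<Rightarrow> 'a l2 \<Rightarrow> 'a l2" is "\<lambda>f g x. f x - g x"
  by (auto intro: L2_diff)
lift_definition uminus_l2 :: "'a l2 \<Rightarrow> 'a l2" is "\<lambda>f x. - f x"
  by (auto intro: L2_uminus)
lift_definition scaleR_l2 :: "real \<Rightarrow> 'a l2 \<Rightarrow> 'a l2" is "\<lambda>r f x. complex_of_real r * f x"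
  by (auto intro: L2_cmult)
instance
proof
  fix F G K :: "'a l2" and r s :: real
  show "F + G + K = F + (G + K)" by transfer (auto intro!: L2_add simp: add.assoc)
  show "F + G = G + F" by transfer (auto intro!: L2_add simp: add.commute)
  show "0 + F = F" by transfer auto
  show "- F + F = 0" by transfer auto
  show "F - G = F + - G" by transfer (auto intro!: L2_diff)
  show "r *\<^sub>R (F + G) = r *\<^sub>R F + r *\<^sub>R G"
    by transfer (auto intro!: L2_add L2_cmult simp: distrib_left)
  show "(r + s) *\<^sub>R F = r *\<^sub>R F + s *\<^sub>R F"
    by transfer (auto intro!: L2_add L2_cmult simp: distrib_right)
  show "r *\<^sub>R s *\<^sub>R F = (r * s) *\<^sub>R F" by transfer (auto intro!: L2_cmult)
  show "1 *\<^sub>R F = F" by transfer auto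
qed

end

instantiation l2 :: (euclidean_space) real_inner
begin

text \<open>Taking the real part loses nothing: the imaginary part of \<open>L2_inner\<close>
  reappears when one argument is multiplied by the imaginary unit.\<close>

lift_definition inner_l2 :: "'a l2 \<Rightarrow> 'a l2 \<Rightarrow> real" is "\<lambda>f g. Re (L2_inner lborel f g)"
  by (rule arg_cong[where f = Re], rule L2_inner_cong_AE) auto

definition norm_l2 :: "'a l2 \<Rightarrow> real" where "norm_l2 F = sqrt (inner F F)"
definition sgn_l2 :: "'a l2 \<Rightarrow> 'a l2" where "sgn_l2 F = scaleR (inverse (norm F)) F"
definition dist_l2 :: "'a l2 \<Rightarrow> 'a l2 \<Rightarrow> real" where "dist_l2 F G = norm (F - G)"
definition uniformity_l2 :: "('a l2 \<times> 'a l2) filter"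
  where "uniformity_l2 = (INF e\<in>{0<..}. principal {(F, G). dist F G < e})"
definition open_l2 :: "'a l2 set \<Rightarrow> bool"
  where "open_l2 U = (\<forall>F\<in>U. eventually (\<lambda>(F', G). F' = F \<longrightarrow> G \<in> U) uniformity)"

instance
proof
  fix F G K :: "'a l2" and r s :: real
  show "sgn F = F /\<^sub>R norm F" by (simp add: sgn_l2_def)
  show "dist F G = norm (F - G)" by (simp add: dist_l2_def)
  show "(uniformity :: ('a l2 \<times> 'a l2) filter) = (INF e\<in>{0<..}. principal {(F, G). dist F G < e})"
    by (simp add: uniformity_l2_def)
  show "open U \<longleftrightarrow> (\<forall>F\<in>U. eventually (\<lambda>(F', G). F' = F \<longrightarrow> G \<in> U) uniformity)" for U :: "'a l2 set"
    by (simp add: open_l2_def)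
  show "norm F = sqrt (inner F F)" by (simp add: norm_l2_def)
  show "inner F G = inner G F"
  proof transfer
    fix f g :: "'a \<Rightarrow> complex"
    have "cnj (L2_inner lborel f g) = L2_inner lborel g f"
      unfolding L2_inner_def by (subst Bochner_Integration.integral_cnj[symmetric]) (simp add: mult.commute)
    then show "Re (L2_inner lborel f g) = Re (L2_inner lborel g f)" by (metis cnj.simps(1))
  qed
  show "inner (F + G) K = inner F K + inner G K"
    by transfer (simp add: L2_inner_def distrib_right integrable_L2_mult)
  show "inner (r *\<^sub>R F) G = r * inner F G"
    by transfer (simp add: L2_inner_def mult.assoc)
  show "0 \<le> inner F F" by transfer (simp add: L2_inner_self)
  show "inner F F = 0 \<longleftrightarrow> F = 0"
    by transfer (auto simp: L2_inner_self integral_nonneg_eq_0_iff_AE L2_def)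
qed

end

lemma norm_abs_l2: "f \<in> L2 lborel \<Longrightarrow> norm (abs_l2 f) = L2_norm lborel f"
  by (simp add: norm_l2_def inner_l2.abs_eq L2_inner_self L2_norm_def)

lemma abs_l2_eq_iff:
  "f \<in> L2 lborel \<Longrightarrow> g \<in> L2 lborel \<Longrightarrow> abs_l2 f = abs_l2 g \<longleftrightarrow> (AE x in lborel. f x = g x)"
  using Quotient3_rel[OF Quotient3_l2, of f g] by simp

lemma rep_l2_L2 [simp]: "rep_l2 F \<in> L2 lborel"
  using Quotient3_rep_reflp[OF Quotient3_l2, of F] by simp

lemma abs_rep_l2 [simp]: "abs_l2 (rep_l2 F) = F"
  by (rule Quotient3_abs_rep[OF Quotient3_l2])

lemma rep_abs_l2: "f \<in> L2 lborel \<Longrightarrow> AE x in lborel. rep_l2 (abs_l2 f) x = f x"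
  by (subst abs_l2_eq_iff[symmetric]) auto

lemma abs_l2_add: "f \<in> L2 lborel \<Longrightarrow> g \<in> L2 lborel \<Longrightarrow> abs_l2 (\<lambda>x. f x + g x) = abs_l2 f + abs_l2 g"
  by (simp add: plus_l2.abs_eq)
lemma abs_l2_diff: "f \<in> L2 lborel \<Longrightarrow> g \<in> L2 lborel \<Longrightarrow> abs_l2 (\<lambda>x. f x - g x) = abs_l2 f - abs_l2 g"
  by (simp add: minus_l2.abs_eq)
lemma abs_l2_uminus: "f \<in> L2 lborel \<Longrightarrow> abs_l2 (\<lambda>x. - f x) = - abs_l2 f"
  by (simp add: uminus_l2.abs_eq)
lemma abs_l2_scaleR: "f \<in> L2 lborel \<Longrightarrow> abs_l2 (\<lambda>x. of_real r * f x) = r *\<^sub>R abs_l2 f"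
  by (simp add: scaleR_l2.abs_eq)

text \<open>Multiplication by a positive square-integrable weight turns an \<open>L\<^sup>2\<close>-Cauchy sequence into an
  \<open>L\<^sup>1\<close>-Cauchy one, for which the library provides an almost everywhere convergent subsequence.\<close>

instance l2 :: (euclidean_space) complete_space
proof
  fix F :: "nat \<Rightarrow> 'a l2"
  assume F: "Cauchy F"
  define f where "f = (\<lambda>n. rep_l2 (F n))"
  have fL: "f n \<in> L2 lborel" for n by (simp add: f_def)
  have [measurable]: "f n \<in> borel_measurable lborel" for n using fL by (rule L2_measurable)
  have Ff: "F n = abs_l2 (f n)" for n by (simp add: f_def)
  have Fd: "norm (F m - F n) = L2_norm lborel (\<lambda>x. f m x - f n x)" for m n
    unfolding Ff abs_l2_diff[OF fL fL, symmetric] by (rule norm_abs_l2[OF L2_diff[OF fL fL]])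
  obtain w :: "'a \<Rightarrow> real" where w[measurable]: "w \<in> borel_measurable lborel"
    and w0: "\<And>x. w x > 0" and w1: "\<And>x. w x \<le> 1" and wi: "integrable lborel w"
    by (rule sigma_finite_measure.obtain_positive_integrable_function[OF sigma_finite_lborel]) blast
  have wL: "(\<lambda>x. complex_of_real (w x)) \<in> L2 lborel"
  proof -
    have "integrable lborel (\<lambda>x. (w x)\<^sup>2)"
      by (rule Bochner_Integration.integrable_bound[OF wi])
        (use w0 w1 in \<open>auto simp: power2_eq_square less_imp_le mult_left_le\<close>)
    then show ?thesis by (auto simp: L2_def)
  qed
  define W where "W = norm (abs_l2 (\<lambda>x. complex_of_real (w x)))"
  have L1: "(\<integral>x. norm (f m x * w x - f n x * w x) \<partial>lborel) \<le> norm (F m - F n) * W" for m n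
  proof -
    define g where "g = (\<lambda>x. complex_of_real (cmod (f m x - f n x)))"
    have gL: "g \<in> L2 lborel" using L2_diff[OF fL[of m] fL[of n]] by (auto simp: g_def L2_def)
    have "(\<integral>x. norm (f m x * w x - f n x * w x) \<partial>lborel) = Re (L2_inner lborel g (\<lambda>x. of_real (w x)))"
    proof -
      have "L2_inner lborel g (\<lambda>x. of_real (w x)) = of_real (\<integral>x. cmod (f m x - f n x) * w x \<partial>lborel)"
        unfolding L2_inner_def g_def by (simp flip: integral_complex_of_real)
      moreover have "norm (f m x * w x - f n x * w x) = cmod (f m x - f n x) * w x" for x
        using w0[of x] by (simp add: norm_mult flip: left_diff_distrib)
      ultimately show ?thesis by simp
    qed
    also have "\<dots> = inner (abs_l2 g) (abs_l2 (\<lambda>x. complex_of_real (w x)))"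
      using gL wL by (simp add: inner_l2.abs_eq)
    also have "\<dots> \<le> norm (abs_l2 g) * W" unfolding W_def by (rule norm_cauchy_schwarz)
    also have "norm (abs_l2 g) = norm (F m - F n)"
      unfolding Fd norm_abs_l2[OF gL] by (simp add: L2_norm_def g_def)
    finally show ?thesis .
  qed
  have int: "integrable lborel (\<lambda>x. f n x * w x)" for n
    using integrable_L2_mult[OF fL[of n] wL] by simp
  obtain r where r: "strict_mono r" and AEr: "AE x in lborel. Cauchy (\<lambda>i. f (r i) x * w x)"
  proof (rule cauchy_L1_AE_cauchy_subseq[of lborel "\<lambda>n x. f n x * w x"])
    fix e :: real assume "0 < e"
    \<comment> \<open>\<open>W\<close> is a norm, hence nonnegative; adding 1 makes the divisor
      positive.\<close>
    then have "0 < e / (W + 1)" unfolding W_def by (simp add: add_nonneg_pos)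
    then obtain N where N: "\<And>m n. m \<ge> N \<Longrightarrow> n \<ge> N \<Longrightarrow> norm (F m - F n) < e / (W + 1)"
      using F unfolding Cauchy_iff by metis
    have "(\<integral>x. norm (f m x * w x - f n x * w x) \<partial>lborel) < e" if "m \<ge> N" "n \<ge> N" for m n
    proof -
      have "norm (F m - F n) * W \<le> norm (F m - F n) * (W + 1)"
        by (simp add: mult_left_mono)
      also have "\<dots> < e"
        using N[OF that] pos_less_divide_eq[of "W + 1" "norm (F m - F n)" e]
        unfolding W_def by (simp add: add_nonneg_pos)
      finally show ?thesis using L1[of m n] by simp
    qed
    then show "\<exists>N. \<forall>i\<ge>N. \<forall>j\<ge>N. (\<integral>x. norm (f i x * w x - f j x * w x) \<partial>lborel) < e" by blast
  qed (use int in auto)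
  define h where "h x = lim (\<lambda>i. f (r i) x)" for x
  have [measurable]: "h \<in> borel_measurable lborel" unfolding h_def by measurable
  have conv: "AE x in lborel. (\<lambda>i. f (r i) x) \<longlonglongrightarrow> h x"
    using AEr
  proof eventually_elim
    fix x assume "Cauchy (\<lambda>i. f (r i) x * w x)"
    then have "convergent (\<lambda>i. f (r i) x * w x)" by (rule Cauchy_convergent)
    then have "convergent (\<lambda>i. f (r i) x * w x * inverse (complex_of_real (w x)))"
      by (rule convergent_mult[OF _ convergent_const])
    moreover have "(\<lambda>i. f (r i) x * w x * inverse (complex_of_real (w x))) = (\<lambda>i. f (r i) x)"
      using w0[of x] by (simp add: fun_eq_iff)
    ultimately have "convergent (\<lambda>i. f (r i) x)" by simp
    then show "(\<lambda>i. f (r i) x) \<longlonglongrightarrow> h x" by (simp add: h_def convergent_LIMSEQ_iff)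
  qed
  \<comment> \<open>Fatou's lemma along the almost everywhere convergent subsequence carries the
    Cauchy estimate over to the limit \<open>h\<close>.\<close>
  have key: "(\<integral>\<^sup>+x. ennreal ((cmod (f n x - h x))\<^sup>2) \<partial>lborel) \<le> ennreal (e\<^sup>2)"
    if N: "\<And>m. m \<ge> N \<Longrightarrow> norm (F n - F m) \<le> e" and "0 \<le> e" for n N e
  proof -
    have "(\<integral>\<^sup>+x. ennreal ((cmod (f n x - h x))\<^sup>2) \<partial>lborel)
        = (\<integral>\<^sup>+x. liminf (\<lambda>i. ennreal ((cmod (f n x - f (r i) x))\<^sup>2)) \<partial>lborel)"
    proof (rule nn_integral_cong_AE, use conv in eventually_elim)
      fix x assume "(\<lambda>i. f (r i) x) \<longlonglongrightarrow> h x"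
      then have "(\<lambda>i. ennreal ((cmod (f n x - f (r i) x))\<^sup>2)) \<longlonglongrightarrow> ennreal ((cmod (f n x - h x))\<^sup>2)"
        by (intro tendsto_intros)
      from lim_imp_Liminf[OF _ this]
      show "ennreal ((cmod (f n x - h x))\<^sup>2) = liminf (\<lambda>i. ennreal ((cmod (f n x - f (r i) x))\<^sup>2))"
        by simp
    qed
    also have "\<dots> \<le> liminf (\<lambda>i. \<integral>\<^sup>+x. ennreal ((cmod (f n x - f (r i) x))\<^sup>2) \<partial>lborel)"
      by (rule nn_integral_liminf) simp
    also have "\<dots> \<le> limsup (\<lambda>i. \<integral>\<^sup>+x. ennreal ((cmod (f n x - f (r i) x))\<^sup>2) \<partial>lborel)"
      by (rule Liminf_le_Limsup) simp
    also have "\<dots> \<le> ennreal (e\<^sup>2)"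
    proof (rule Limsup_bounded, rule eventually_sequentiallyI[of N])
      fix i assume "N \<le> i"
      then have "N \<le> r i" using seq_suble[OF r, of i] by simp
      have "(\<integral>\<^sup>+x. ennreal ((cmod (f n x - f (r i) x))\<^sup>2) \<partial>lborel)
          = ennreal (\<integral>x. (cmod (f n x - f (r i) x))\<^sup>2 \<partial>lborel)"
        by (rule nn_integral_eq_integral) (use L2_diff[OF fL[of n] fL[of "r i"]] in \<open>auto simp: L2_def\<close>)
      also have "(\<integral>x. (cmod (f n x - f (r i) x))\<^sup>2 \<partial>lborel) = (norm (F n - F (r i)))\<^sup>2"
        unfolding Fd L2_norm_def by simp
      also have "\<dots> \<le> e\<^sup>2" using N[OF \<open>N \<le> r i\<close>] by (intro power_mono) auto
      finally show "(\<integral>\<^sup>+x. ennreal ((cmod (f n x - f (r i) x))\<^sup>2) \<partial>lborel) \<le> ennreal (e\<^sup>2)"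
        by (simp add: ennreal_leI)
    qed
    finally show ?thesis .
  qed
  have key2: "(\<lambda>x. f n x - h x) \<in> L2 lborel \<and> L2_norm lborel (\<lambda>x. f n x - h x) \<le> e"
    if N: "\<And>m. m \<ge> N \<Longrightarrow> norm (F n - F m) \<le> e" and "0 \<le> e" for n N e
  proof -
    have k: "(\<integral>\<^sup>+x. ennreal ((cmod (f n x - h x))\<^sup>2) \<partial>lborel) \<le> ennreal (e\<^sup>2)"
      by (rule key) (fact that)+
    also have "ennreal (e\<^sup>2) < \<infinity>" by simp
    finally have i: "integrable lborel (\<lambda>x. (cmod (f n x - h x))\<^sup>2)"
      by (intro integrableI_bounded) simp_all
    then have "(\<integral>x. (cmod (f n x - h x))\<^sup>2 \<partial>lborel) \<le> e\<^sup>2"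
      using k nn_integral_eq_integral[OF i] by (simp add: ennreal_le_iff)
    then show ?thesis using i \<open>0 \<le> e\<close>
      by (auto simp: L2_def L2_norm_def real_le_lsqrt intro: real_le_lsqrt)
  qed
  obtain N0 where "\<And>m n. m \<ge> N0 \<Longrightarrow> n \<ge> N0 \<Longrightarrow> norm (F m - F n) < 1"
    using F unfolding Cauchy_iff by (meson zero_less_one)
  then have "(\<lambda>x. f N0 x - h x) \<in> L2 lborel"
    using key2[of N0 N0 1] by (metis less_imp_le order_refl zero_le_one)
  from L2_diff[OF fL[of N0] this] have hL: "h \<in> L2 lborel" by simp
  have "F \<longlonglongrightarrow> abs_l2 h"
  proof (rule LIMSEQ_I)
    fix e :: real assume "0 < e"
    then obtain N where N: "\<And>m n. m \<ge> N \<Longrightarrow> n \<ge> N \<Longrightarrow> norm (F m - F n) < e / 2"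
      using F unfolding Cauchy_iff by (metis half_gt_zero)
    have "norm (F n - abs_l2 h) < e" if "n \<ge> N" for n
    proof -
      have "norm (F n - abs_l2 h) = L2_norm lborel (\<lambda>x. f n x - h x)"
        unfolding Ff abs_l2_diff[OF fL hL, symmetric] by (rule norm_abs_l2[OF L2_diff[OF fL hL]])
      also have "\<dots> \<le> e / 2"
        using key2[of N n "e / 2"] N[OF that] \<open>0 < e\<close> by (simp add: less_imp_le)
      finally show ?thesis using \<open>0 < e\<close> by simp
    qed
    then show "\<exists>N. \<forall>n\<ge>N. norm (F n - abs_l2 h) < e" by blast
  qed
  then show "convergent F" by (auto simp: convergent_def)
qed

section \<open>Self-adjoint relations and semigroups on a real Hilbert space\<close>

text \<open>Baire category: the closed sets \<open>S k\<close> cover a complete space, so one of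
  them contains a ball, and linearity turns a bound on a ball into an operator bound.\<close>

lemma uniform_boundedness:
  fixes T :: "nat \<Rightarrow> 'e::{real_normed_vector, complete_space} \<Rightarrow> 'f::real_normed_vector"
  assumes T: "\<And>n. bounded_linear (T n)" and bd: "\<And>x. \<exists>k. \<forall>n. norm (T n x) \<le> k"
  shows "\<exists>C. \<forall>n x. norm (T n x) \<le> C * norm x"
proof -
  define S where "S k = {x. \<forall>n. norm (T n x) \<le> real k}" for k :: nat
  have cl: "closed (S k)" for k
  proof -
    have "S k = (\<Inter>n. {x. norm (T n x) \<le> real k})" by (auto simp: S_def)
    moreover have "closed {x. norm (T n x) \<le> real k}" for n
      by (intro closed_Collect_le continuous_intros linear_continuous_on T)
    ultimately show ?thesis by auto
  qed
  have U: "(\<Union>k. S k) = UNIV"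
  proof -
    have "x \<in> (\<Union>k. S k)" for x
    proof -
      obtain k where "\<forall>n. norm (T n x) \<le> k" using bd by blast
      moreover obtain m :: nat where "k \<le> real m" using real_arch_simple by blast
      ultimately show ?thesis unfolding S_def by (auto intro: order_trans)
    qed
    then show ?thesis by auto
  qed
  have "\<exists>k. interior (S k) \<noteq> {}"
  proof (rule ccontr)
    assume "\<not> ?thesis"
    then have "Met_TC.mtopology interior_of \<Union>(range S) = {}"
      by (intro Met_TC.metric_Baire_category_alt)
        (use cl in \<open>auto simp: Met_TC.mcomplete_def Met_TC.MCauchy_def complete_UNIV\<close>)
    then show False using U by simp
  qed
  then obtain k x0 where "x0 \<in> interior (S k)" by blast
  then obtain e where e: "e > 0" "cball x0 e \<subseteq> S k"
    using mem_interior_cball by blast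
  \<comment> \<open>A vector of norm \<open>e\<close> is a difference of two points of the ball
    inside \<open>S k\<close>, whence the factor 2 and the division by \<open>e\<close>.\<close>
  have "norm (T n x) \<le> (2 * real k / e) * norm x" for n x
  proof (cases "x = 0")
    case True then show ?thesis using bounded_linear.linear[OF T] linear_0 by force
  next
    case False
    interpret bounded_linear "T n" by (rule T)
    define y where "y = (e / norm x) *\<^sub>R x"
    have "norm y = e" using False e by (simp add: y_def)
    then have "x0 + y \<in> S k" "x0 \<in> S k" using e by (auto intro!: subsetD[OF e(2)] simp: dist_norm)
    then have "norm (T n (x0 + y)) \<le> k" "norm (T n x0) \<le> k" by (auto simp: S_def)
    moreover have "T n y = T n (x0 + y) - T n x0" by (simp add: add)
    ultimately have "norm (T n y) \<le> 2 * real k" using norm_triangle_ineq4[of "T n (x0 + y)" "T n x0"] by simp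
    then have "(e / norm x) * norm (T n x) \<le> 2 * real k" using e by (simp add: y_def scaleR)
    then show ?thesis using e False by (simp add: field_simps)
  qed
  then show ?thesis by blast
qed

text \<open>Nearest-point projection: a minimizing sequence for the distance from \<open>h\<close>
  to \<open>S\<close> converges in \<open>S\<close>, and the remaining error is orthogonal to
  \<open>S\<close>, hence zero.\<close>

lemma closed_subspace_eq_UNIV:
  fixes S :: "'e::{real_inner, complete_space} set"
  assumes S: "subspace S" and cl: "closed S" and orth: "\<And>u. (\<And>v. v \<in> S \<Longrightarrow> inner v u = 0) \<Longrightarrow> u = 0"
  shows "S = UNIV"
proof -
  have "h \<in> S" for h
  proof -
    define d where "d = infdist h S"
    have ne: "S \<noteq> {}" using subspace_0[OF S] by auto
    have d: "d \<le> norm (h - v)" if "v \<in> S" for v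
      using infdist_le[OF that, of h] by (simp add: d_def dist_norm)
    have d0: "0 \<le> d" by (simp add: d_def infdist_nonneg)
    have "\<exists>v\<in>S. norm (h - v) < d + 1 / real (Suc n)" for n
    proof (rule ccontr)
      assume "\<not> ?thesis"
      then have "d + 1 / real (Suc n) \<le> infdist h S"
        unfolding infdist_notempty[OF ne] using ne by (intro cINF_greatest) (auto simp: dist_norm not_less)
      then show False by (simp add: d_def)
    qed
    then obtain v where vS: "\<And>n. v n \<in> S" and v: "\<And>n. norm (h - v n) < d + 1 / real (Suc n)" by metis
    \<comment> \<open>Parallelogram law; the midpoint of \<open>v m\<close> and \<open>v n\<close>
      is again in \<open>S\<close>, so its distance from \<open>h\<close> is at least
      \<open>d\<close>.\<close>
    have par: "(norm (v m - v n))\<^sup>2 \<le> 2 * (norm (h - v m))\<^sup>2 + 2 * (norm (h - v n))\<^sup>2 - 4 * d\<^sup>2" for m n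
    proof -
      have "(1/2) *\<^sub>R (v m + v n) \<in> S" using S vS by (intro subspace_scale subspace_add)
      then have "d\<^sup>2 \<le> (norm (h - (1/2) *\<^sub>R (v m + v n)))\<^sup>2" using d d0 by (intro power_mono) auto
      moreover have "(norm (v m - v n))\<^sup>2 + 4 * (norm (h - (1/2) *\<^sub>R (v m + v n)))\<^sup>2
          = 2 * (norm (h - v m))\<^sup>2 + 2 * (norm (h - v n))\<^sup>2"
        by (simp add: power2_norm_eq_inner inner_simps inner_commute algebra_simps)
      ultimately show ?thesis by linarith
    qed
    have lim: "(\<lambda>n. norm (h - v n)) \<longlonglongrightarrow> d"
    proof (rule real_tendsto_sandwich[OF _ _ tendsto_const])
      show "\<forall>\<^sub>F n in sequentially. d \<le> norm (h - v n)" using d vS by simp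
      show "\<forall>\<^sub>F n in sequentially. norm (h - v n) \<le> d + 1 / real (Suc n)" using v by (intro always_eventually allI less_imp_le)
      show "(\<lambda>n. d + 1 / real (Suc n)) \<longlonglongrightarrow> d"
        using tendsto_add[OF tendsto_const LIMSEQ_inverse_real_of_nat, of d] by (simp add: inverse_eq_divide)
    qed
    have "Cauchy v"
    proof (rule CauchyI)
      fix e :: real assume "0 < e"
      have "(\<lambda>n. (norm (h - v n))\<^sup>2) \<longlonglongrightarrow> d\<^sup>2" by (intro tendsto_intros lim)
      \<comment> \<open>The margin \<open>e\<^sup>2 / 4\<close> is chosen so that \<open>par\<close>
        yields exactly \<open>e\<^sup>2\<close>.\<close>
      then have "\<forall>\<^sub>F n in sequentially. (norm (h - v n))\<^sup>2 < d\<^sup>2 + e\<^sup>2 / 4"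
        using \<open>0 < e\<close> by (intro order_tendstoD(2)) auto
      then obtain N where N: "\<And>n. n \<ge> N \<Longrightarrow> (norm (h - v n))\<^sup>2 < d\<^sup>2 + e\<^sup>2 / 4"
        by (auto simp: eventually_sequentially)
      have "norm (v m - v n) < e" if "m \<ge> N" "n \<ge> N" for m n
      proof -
        have "(norm (v m - v n))\<^sup>2 < e\<^sup>2" using par[of m n] N[OF that(1)] N[OF that(2)] by linarith
        then show ?thesis using \<open>0 < e\<close> by (auto intro: power_less_imp_less_base)
      qed
      then show "\<exists>N. \<forall>m\<ge>N. \<forall>n\<ge>N. norm (v m - v n) < e" by blast
    qed
    then obtain w where w: "v \<longlonglongrightarrow> w" using Cauchy_convergent by (auto simp: convergent_def)
    have wS: "w \<in> S" using closed_sequentially[OF cl vS w] .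
    have wd: "norm (h - w) = d"
      by (rule LIMSEQ_unique[OF _ lim]) (intro tendsto_intros w)
    have "inner y (h - w) = 0" if y: "y \<in> S" for y
    proof (cases "y = 0")
      case False
      \<comment> \<open>This \<open>s\<close> minimizes the norm of
        \<open>(h - w) - s *\<^sub>R y\<close>; a nonzero inner product would bring a point of
        \<open>S\<close> closer to \<open>h\<close> than \<open>d\<close>.\<close>
      define s where "s = inner y (h - w) / (norm y)\<^sup>2"
      have "w + s *\<^sub>R y \<in> S" using S wS y by (intro subspace_add subspace_scale)
      then have "d\<^sup>2 \<le> (norm ((h - w) - s *\<^sub>R y))\<^sup>2"
        using d[of "w + s *\<^sub>R y"] d0 by (intro power_mono) (auto simp: algebra_simps)
      also have "\<dots> = d\<^sup>2 - 2 * s * inner y (h - w) + s\<^sup>2 * (norm y)\<^sup>2"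
        unfolding wd[symmetric] power2_norm_eq_inner
        by (simp add: inner_diff_left inner_diff_right inner_commute algebra_simps power2_eq_square)
      also have "\<dots> = d\<^sup>2 - (inner y (h - w))\<^sup>2 / (norm y)\<^sup>2"
        using False by (simp add: s_def power2_eq_square field_simps)
      finally have "(inner y (h - w))\<^sup>2 / (norm y)\<^sup>2 \<le> 0" by simp
      then show ?thesis using False by (simp add: divide_le_0_iff)
    qed simp
    then have "h - w = 0" by (rule orth)
    then show ?thesis using wS by simp
  qed
  then show ?thesis by auto
qed

text \<open>Coercivity bounds \<open>norm f\<close> by a multiple of \<open>norm g\<close>, which
  makes the range closed; the orthogonality condition makes it dense. The formulation through a
  closed relation covers unbounded operators.\<close>

lemma coercive_surj:
  fixes G :: "('e::{real_inner, complete_space} \<times> 'e) set"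
  assumes G: "subspace G" and cl: "closed G" and "0 < \<delta>"
    and coer: "\<And>f g. (f, g) \<in> G \<Longrightarrow> \<delta> * (norm f)\<^sup>2 \<le> inner g f"
    and orth: "\<And>u. (\<And>f g. (f, g) \<in> G \<Longrightarrow> inner g u = 0) \<Longrightarrow> u = 0"
  shows "snd ` G = UNIV"
proof (rule closed_subspace_eq_UNIV)
  have bd: "\<delta> * norm f \<le> norm g" if "(f, g) \<in> G" for f g
  proof (cases "f = 0")
    case False
    have "\<delta> * norm f * norm f \<le> norm g * norm f"
      using coer[OF that] norm_cauchy_schwarz[of g f] by (simp add: power2_eq_square mult.assoc)
    then show ?thesis using False by simp
  qed (use \<open>0 < \<delta>\<close> in simp)
  show "subspace (snd ` G)" using linear_snd G by (rule linear_subspace_image)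
  show "closed (snd ` G)"
  proof (rule closed_sequential_limits[THEN iffD2], intro allI impI, elim conjE)
    fix y l assume y: "\<forall>n. y n \<in> snd ` G" and l: "y \<longlonglongrightarrow> l"
    then have "\<forall>n. \<exists>x. (x, y n) \<in> G" by force
    then obtain x where x: "\<And>n. (x n, y n) \<in> G" by metis
    have "Cauchy x"
    proof (rule CauchyI)
      fix e :: real assume "0 < e"
      then have "0 < \<delta> * e" using \<open>0 < \<delta>\<close> by simp
      then obtain N where N: "\<And>m n. m \<ge> N \<Longrightarrow> n \<ge> N \<Longrightarrow> norm (y m - y n) < \<delta> * e"
        using LIMSEQ_imp_Cauchy[OF l] unfolding Cauchy_iff by metis
      have "norm (x m - x n) < e" if "m \<ge> N" "n \<ge> N" for m n
      proof -
        have "(x m - x n, y m - y n) \<in> G" using subspace_diff[OF G x[of m] x[of n]] by simp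
        from bd[OF this] N[OF that] have "\<delta> * norm (x m - x n) < \<delta> * e" by linarith
        then show ?thesis using \<open>0 < \<delta>\<close> by simp
      qed
      then show "\<exists>N. \<forall>m\<ge>N. \<forall>n\<ge>N. norm (x m - x n) < e" by blast
    qed
    then obtain k where k: "x \<longlonglongrightarrow> k" using Cauchy_convergent by (auto simp: convergent_def)
    have "(k, l) \<in> G" using closed_sequentially[OF cl x tendsto_Pair[OF k l]] .
    then show "l \<in> snd ` G" by force
  qed
  fix u assume "\<And>v. v \<in> snd ` G \<Longrightarrow> inner v u = 0"
  then show "u = 0" by (intro orth) force
qed


section \<open>Self-adjoint relations and the infimum of the numerical range\<close>

lemma adjoint_graph_subspace_closed:
  fixes H :: "('e::real_inner \<times> 'e) set"
  assumes sa: "H = {(u, v). \<forall>(f, g)\<in>H. inner g u = inner f v}"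
  shows "subspace H" "closed H"
proof -
  \<comment> \<open>Each pair of \<open>H\<close> imposes one linear equation on \<open>p\<close>,
    so an adjoint relation is an intersection of closed subspaces.\<close>
  have eq: "H = (\<Inter>(f, g)\<in>H. {p. inner g (fst p) = inner f (snd p)})"
    by (subst sa) auto
  have "subspace (\<Inter>(f, g)\<in>H. {p. inner g (fst p) = inner f (snd p)})"
    unfolding case_prod_unfold by (auto simp: subspace_def inner_add_right)
  then show "subspace H" using eq by simp
  have "closed (\<Inter>(f, g)\<in>H. {p. inner g (fst p) = inner f (snd p)})"
    by (auto intro!: closed_INT closed_Collect_eq continuous_intros)
  then show "closed H" using eq by simp
qed

text \<open>The skew map \<open>J\<close> contributes nothing to the quadratic form, so
  \<open>H - a - b J\<close> is coercive with constant \<open>c - a\<close>, whatever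
  \<open>b\<close> is. With \<open>J\<close> the imaginary unit this reaches every spectral
  parameter with real part below \<open>c\<close>.\<close>

lemma self_adjoint_resolvent_surj:
  fixes H :: "('e::{real_inner, complete_space} \<times> 'e) set"
  assumes sa: "H = {(u, v). \<forall>(f, g)\<in>H. inner g u = inner f v}"
    and lower: "\<And>f g. (f, g) \<in> H \<Longrightarrow> c * (norm f)\<^sup>2 \<le> inner g f"
    and J: "bounded_linear J" and skew: "\<And>f g. inner (J f) g = - inner f (J g)"
    and "a < c"
  shows "\<exists>(f, g)\<in>H. g - a *\<^sub>R f - b *\<^sub>R J f = h"
proof -
  interpret J: bounded_linear J by (rule J)
  have J0: "inner (J f) f = 0" for f using skew[of f f] by (simp add: inner_commute)
  \<comment> \<open>The graph of \<open>H - a - b J\<close>, written as a preimage of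
    \<open>H\<close> so that linearity and closedness carry over.\<close>
  define G where "G = (\<lambda>(f, k). (f, k + a *\<^sub>R f + b *\<^sub>R J f)) -` H"
  have G: "(f, g) \<in> G \<longleftrightarrow> (f, g + a *\<^sub>R f + b *\<^sub>R J f) \<in> H" for f g by (simp add: G_def)
  have GH: "(f, g - a *\<^sub>R f - b *\<^sub>R J f) \<in> G" if "(f, g) \<in> H" for f g using that by (simp add: G)
  have "snd ` G = UNIV"
  proof (rule coercive_surj[where \<delta> = "c - a"])
    have "linear (\<lambda>(f, k). (f, k + a *\<^sub>R f + b *\<^sub>R J f))"
      by (rule linearI) (auto simp: J.add J.scaleR algebra_simps)
    then show "subspace G" unfolding G_def
      using adjoint_graph_subspace_closed(1)[OF sa] by (rule linear_subspace_vimage)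
    have "continuous_on UNIV (\<lambda>p. (fst p, snd p + a *\<^sub>R fst p + b *\<^sub>R J (fst p)))"
      by (intro continuous_intros J.continuous_on)
    then show "closed G" unfolding G_def case_prod_unfold
      by (intro closed_vimage adjoint_graph_subspace_closed(2)[OF sa])
    show "0 < c - a" using \<open>a < c\<close> by simp
    show "(c - a) * (norm f)\<^sup>2 \<le> inner g f" if "(f, g) \<in> G" for f g
      using lower[OF that[unfolded G]] J0[of f]
      by (simp add: inner_add_left power2_norm_eq_inner algebra_simps)
    fix u assume u: "\<And>f g. (f, g) \<in> G \<Longrightarrow> inner g u = 0"
    \<comment> \<open>A vector orthogonal to the range lies in the domain of the adjoint, hence of
      \<open>H\<close>; the sign of the \<open>J\<close> term flips by skewness.\<close>
    have "inner g u = inner f (a *\<^sub>R u - b *\<^sub>R J u)" if "(f, g) \<in> H" for f g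
      using u[OF GH[OF that]] skew[of f u] by (simp add: inner_simps)
    then have "(u, a *\<^sub>R u - b *\<^sub>R J u) \<in> H" by (subst sa) auto
    from lower[OF this] have "c * (norm u)\<^sup>2 \<le> a * (norm u)\<^sup>2"
      using J0[of u] by (simp add: inner_diff_left power2_norm_eq_inner)
    then show "u = 0" using \<open>a < c\<close> by (simp add: mult_le_cancel_right)
  qed
  then obtain f where "(f, h) \<in> G" by (metis UNIV_I imageE prod.collapse)
  then show ?thesis by (auto simp: G intro!: bexI[of _ "(f, h + a *\<^sub>R f + b *\<^sub>R J f)"])
qed

text \<open>\<open>b\<close> is the infimum of the numerical range. If \<open>H - b\<close> had an
  inverse bounded by \<open>C\<close>, then \<open>b + 1 / C\<close> would still be a lower bound,
  against the choice of \<open>b\<close>. The nonzero \<open>f0\<close> keeps the set of lower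
  bounds bounded above and forces \<open>C\<close> to be positive.\<close>

lemma self_adjoint_lower_bound_spectral:
  fixes H :: "('e::real_inner \<times> 'e) set"
  assumes sa: "H = {(u, v). \<forall>(f, g)\<in>H. inner g u = inner f v}"
    and lower: "\<And>f g. (f, g) \<in> H \<Longrightarrow> c * (norm f)\<^sup>2 \<le> inner g f"
    and nz: "(f0, g0) \<in> H" "f0 \<noteq> 0"
  obtains b where "\<And>f g. (f, g) \<in> H \<Longrightarrow> b * (norm f)\<^sup>2 \<le> inner g f"
    "\<And>C. (\<And>h. \<exists>(f, g)\<in>H. g - b *\<^sub>R f = h) \<Longrightarrow>
       (\<And>f g. (f, g) \<in> H \<Longrightarrow> norm f \<le> C * norm (g - b *\<^sub>R f)) \<Longrightarrow> False"
proof -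
  have symm: "inner g f' = inner f g'" if "(f, g) \<in> H" "(f', g') \<in> H" for f g f' g'
    using that sa by blast
  define S where "S = {m. \<forall>(f, g)\<in>H. m * (norm f)\<^sup>2 \<le> inner g f}"
  define b where "b = Sup S"
  have "c \<in> S" using lower by (auto simp: S_def)
  have bdd: "bdd_above S"
  proof (rule bdd_aboveI)
    fix m assume "m \<in> S"
    then have "m * (norm f0)\<^sup>2 \<le> inner g0 f0" using nz by (auto simp: S_def)
    then show "m \<le> inner g0 f0 / (norm f0)\<^sup>2" using nz by (simp add: pos_le_divide_eq)
  qed
  have b: "b * (norm f)\<^sup>2 \<le> inner g f" if fg: "(f, g) \<in> H" for f g
  proof (cases "f = 0")
    case False
    have "b \<le> inner g f / (norm f)\<^sup>2"
      unfolding b_def using \<open>c \<in> S\<close> fg False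
      by (intro cSup_least) (auto simp: S_def pos_le_divide_eq)
    then show ?thesis using False by (simp add: pos_le_divide_eq)
  qed simp
  show ?thesis
  proof (rule that[of b])
    fix C
    assume surj: "\<And>h. \<exists>(f, g)\<in>H. g - b *\<^sub>R f = h"
      and C: "\<And>f g. (f, g) \<in> H \<Longrightarrow> norm f \<le> C * norm (g - b *\<^sub>R f)"
    have "0 < C * norm (g0 - b *\<^sub>R f0)" using C[OF nz(1)] nz(2)
      by (meson less_le_trans zero_less_norm_iff)
    then have "0 < C" by (simp add: zero_less_mult_iff)
    have "b + 1 / C \<in> S"
    proof -
      have "(b + 1 / C) * (norm f)\<^sup>2 \<le> inner g f" if fg: "(f, g) \<in> H" for f g
      proof -
        obtain k l where kl: "(k, l) \<in> H" and lk: "l - b *\<^sub>R k = f" using surj[of f] by blast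
        have nk: "norm k \<le> C * norm f" using C[OF kl] lk by simp
        have "inner f k \<le> norm f * norm k" by (rule norm_cauchy_schwarz)
        also have "\<dots> \<le> norm f * (C * norm f)" using nk by (rule mult_left_mono) simp
        finally have fk: "inner f k \<le> C * inner f f"
          by (simp add: power2_norm_eq_inner[symmetric] power2_eq_square algebra_simps)
        \<comment> \<open>The form of \<open>H - b\<close> is nonnegative at this test vector, where
          \<open>k\<close> is the preimage of \<open>f\<close> under \<open>H - b\<close>. In the
          expansion the cross term equals \<open>inner f f\<close> by symmetry and the last term is
          at most \<open>(1/C) * inner f f\<close>, so exactly the gain \<open>1 / C\<close>
          remains.\<close>
        have "(f - (1/C) *\<^sub>R k, g - (1/C) *\<^sub>R l) \<in> H"
          using adjoint_graph_subspace_closed(1)[OF sa] fg kl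
          by (metis diff_Pair scaleR_Pair subspace_diff subspace_scale)
        from b[OF this]
        have "0 \<le> inner ((g - (1/C) *\<^sub>R l) - b *\<^sub>R (f - (1/C) *\<^sub>R k)) (f - (1/C) *\<^sub>R k)"
          by (simp add: inner_diff_left power2_norm_eq_inner)
        also have "(g - (1/C) *\<^sub>R l) - b *\<^sub>R (f - (1/C) *\<^sub>R k) = (g - b *\<^sub>R f) - (1/C) *\<^sub>R f"
          unfolding lk[symmetric] by (simp add: algebra_simps)
        also have "inner \<dots> (f - (1/C) *\<^sub>R k)
            = inner (g - b *\<^sub>R f) f - (1/C) * inner f f
              - (1/C) * inner (g - b *\<^sub>R f) k + (1/C) * (1/C) * inner f k"
          by (simp add: inner_diff_left inner_diff_right algebra_simps)
        also have "inner (g - b *\<^sub>R f) k = inner f f"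
          using symm[OF fg kl] lk by (metis inner_diff_left inner_diff_right inner_scaleR_left inner_scaleR_right)
        also have "(1/C) * (1/C) * inner f k \<le> (1/C) * (1/C) * (C * inner f f)"
          using fk \<open>0 < C\<close> by (intro mult_left_mono) auto
        also have "\<dots> = (1/C) * inner f f" using \<open>0 < C\<close> by simp
        finally show ?thesis by (simp add: inner_diff_left power2_norm_eq_inner distrib_right)
      qed
      then show ?thesis by (auto simp: S_def)
    qed
    then have "b + 1 / C \<le> b" unfolding b_def using bdd by (rule cSup_upper)
    then show False using \<open>0 < C\<close> by simp
  qed (rule b)
qed

section \<open>Symmetric strongly continuous semigroups\<close>

text \<open>\<open>H\<close> is minus the generator, given by the right derivative at time 0.
  Symmetry is required of \<open>H\<close> alone and boundedness of each \<open>T t\<close>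
  separately; symmetry of \<open>T t\<close> and locally uniform bounds are derived.\<close>

locale symmetric_semigroup =
  fixes T :: "real \<Rightarrow> 'e::{real_inner, complete_space} \<Rightarrow> 'e" and H :: "('e \<times> 'e) set"
  assumes bounded_linear: "0 \<le> t \<Longrightarrow> bounded_linear (T t)"
    and zero_time: "T 0 f = f"
    and add_time: "0 \<le> s \<Longrightarrow> 0 \<le> t \<Longrightarrow> T (s + t) f = T s (T t f)"
    and strong_cont: "((\<lambda>t. T t f) \<longlongrightarrow> f) (at_right 0)"
    and gen: "(f, g) \<in> H \<longleftrightarrow> ((\<lambda>t. (T t f - f) /\<^sub>R t) \<longlongrightarrow> - g) (at_right 0)"
    and symm: "(f, g) \<in> H \<Longrightarrow> (f', g') \<in> H \<Longrightarrow> inner g f' = inner f g'"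
    and dense: "closure (Domain H) = UNIV"
begin

text \<open>The filter \<open>at_right 0\<close> leaves out the time 0; \<open>T 0 f = f\<close>
  fills the gap, so strong continuity becomes available along null sequences and along
  \<open>\<bar>s - t\<bar>\<close>.\<close>

lemma tendsto_zero:
  assumes "(\<phi> \<longlongrightarrow> 0) F" "\<forall>\<^sub>F x in F. 0 \<le> \<phi> x"
  shows "((\<lambda>x. T (\<phi> x) f) \<longlongrightarrow> f) F"
proof -
  have "((\<lambda>t. T t f) \<longlongrightarrow> f) (inf (nhds 0) (principal {0..}))"
  proof -
    have "\<forall>\<^sub>F t in inf (nhds 0) (principal {0..}). T t f \<in> S" if "open S" "f \<in> S" for S
      using topological_tendstoD[OF strong_cont that, of] that zero_time
      unfolding eventually_at_filter eventually_inf_principal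
      by (auto elim!: eventually_mono simp: le_less)
    then show ?thesis by (rule topological_tendstoI)
  qed
  moreover have "filterlim \<phi> (inf (nhds 0) (principal {0..})) F"
    using assms by (auto simp: filterlim_inf filterlim_principal)
  ultimately show ?thesis by (rule filterlim_compose)
qed

text \<open>Otherwise there are times \<open>t n\<close> tending to 0 at which the operator norm
  exceeds \<open>n\<close>; but strong continuity bounds \<open>T (t n) x\<close> for each
  \<open>x\<close>, contradicting uniform boundedness.\<close>

lemma bounded_near_zero: "\<exists>\<delta>>0. \<exists>C. \<forall>t\<in>{0..\<delta>}. \<forall>x. norm (T t x) \<le> C * norm x"
proof (rule ccontr)
  assume neg: "\<not> ?thesis"
  have "\<exists>t\<in>{0..1 / real (Suc n)}. \<exists>x. real n * norm x < norm (T t x)" for n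
  proof -
    have "0 < 1 / real (Suc n)" by simp
    then show ?thesis using neg by (meson not_le)
  qed
  then obtain t where t: "\<And>n. t n \<in> {0..1 / real (Suc n)}"
    and ex: "\<And>n. \<exists>x. real n * norm x < norm (T (t n) x)" by metis
  have t0: "t \<longlonglongrightarrow> 0"
  proof (rule real_tendsto_sandwich[OF _ _ tendsto_const])
    show "(\<lambda>n. 1 / real (Suc n)) \<longlonglongrightarrow> 0"
      using LIMSEQ_inverse_real_of_nat by (simp add: inverse_eq_divide)
  qed (use t in auto)
  have "\<exists>k. \<forall>n. norm (T (t n) x) \<le> k" for x
  proof -
    have "(\<lambda>n. T (t n) x) \<longlonglongrightarrow> x" using t0 t by (intro tendsto_zero) auto
    then have "Bseq (\<lambda>n. T (t n) x)" by (intro convergent_imp_Bseq) (auto simp: convergent_def)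
    then show ?thesis by (auto simp: Bseq_def)
  qed
  then obtain C where C: "\<And>n x. norm (T (t n) x) \<le> C * norm x"
    using uniform_boundedness[of "\<lambda>n. T (t n)"] bounded_linear t by force
  obtain n :: nat where "C \<le> real n" using real_arch_simple by blast
  moreover obtain x where "real n * norm x < norm (T (t n) x)" using ex by blast
  ultimately show False using C[of n x] mult_right_mono[of C "real n" "norm x"] by simp
qed

text \<open>The semigroup law composes steps of length \<open>\<delta>\<close>; \<open>C\<close> is
  at least 1 so that its powers increase.\<close>

lemma locally_bounded: "\<exists>C\<ge>0. \<forall>t\<in>{0..R}. \<forall>x. norm (T t x) \<le> C * norm x"
proof -
  obtain \<delta> C0 where "0 < \<delta>" and C0: "\<And>t x. t \<in> {0..\<delta>} \<Longrightarrow> norm (T t x) \<le> C0 * norm x"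
    using bounded_near_zero by blast
  define C where "C = max 1 C0"
  have C: "norm (T t x) \<le> C * norm x" if "t \<in> {0..\<delta>}" for t x
    using C0[OF that, of x] mult_right_mono[of C0 C "norm x"] by (simp add: C_def)
  have "1 \<le> C" by (simp add: C_def)
  have *: "norm (T t x) \<le> C ^ n * norm x" if "t \<in> {0..real n * \<delta>}" for n t x
    using that
  proof (induction n arbitrary: t x)
    case (Suc n)
    show ?case
    proof (cases "t \<le> \<delta>")
      case True
      then have "norm (T t x) \<le> C * norm x" using C Suc.prems by simp
      also have "\<dots> \<le> C ^ Suc n * norm x"
        using \<open>1 \<le> C\<close> by (intro mult_right_mono) (auto simp: self_le_power)
      finally show ?thesis .
    next
      case False
      have "norm (T t x) = norm (T (t - \<delta>) (T \<delta> x))"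
        using add_time[of "t - \<delta>" \<delta> x] False \<open>0 < \<delta>\<close> by simp
      also have "\<dots> \<le> C ^ n * norm (T \<delta> x)"
        using Suc.prems False by (intro Suc.IH) (auto simp: algebra_simps)
      also have "\<dots> \<le> C ^ n * (C * norm x)"
        using C[of \<delta> x] \<open>0 < \<delta>\<close> \<open>1 \<le> C\<close> by (intro mult_left_mono) auto
      finally show ?thesis by (simp add: algebra_simps)
    qed
  qed (simp add: zero_time)
  obtain n :: nat where "R \<le> real n * \<delta>"
    using real_arch_simple[of "R / \<delta>"] \<open>0 < \<delta>\<close> by (auto simp: pos_divide_le_eq)
  then show ?thesis using * \<open>1 \<le> C\<close> by (intro exI[of _ "C ^ n"]) auto
qed

text \<open>Taking out \<open>T (min s t)\<close> reduces left and right increments at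
  \<open>t\<close> alike to an increment from time 0. The vector \<open>k\<close> is 0 for
  continuity and \<open>T t g\<close> for the derivative.\<close>

lemma split_min:
  assumes "0 \<le> s" "0 \<le> t"
  shows "norm (T s f - T t f + (s - t) *\<^sub>R k) = norm (T (min s t) (T \<bar>s - t\<bar> f) - T (min s t) f + \<bar>s - t\<bar> *\<^sub>R k)"
proof (cases "t \<le> s")
  case True
  then show ?thesis using assms add_time[of t "s - t" f] by (simp add: min_def)
next
  case False
  then have "T s f - T t f + (s - t) *\<^sub>R k = - (T s (T (t - s) f) - T s f + (t - s) *\<^sub>R k)"
    using assms add_time[of s "t - s" f] by (simp add: algebra_simps)
  then have "norm (T s f - T t f + (s - t) *\<^sub>R k) = norm (T s (T (t - s) f) - T s f + (t - s) *\<^sub>R k)"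
    by (simp only: norm_minus_cancel)
  then show ?thesis using False by (simp add: min_def)
qed

lemma continuous: "continuous_on {0..} (\<lambda>t. T t f)"
  unfolding continuous_on_def
proof
  fix t :: real assume "t \<in> {0..}"
  then have t: "0 \<le> t" by simp
  obtain C where "0 \<le> C" and C: "\<And>r x. r \<in> {0..t + 1} \<Longrightarrow> norm (T r x) \<le> C * norm x"
    using locally_bounded by blast
  have abs0: "((\<lambda>s. \<bar>s - t\<bar>) \<longlongrightarrow> 0) (at t within {0..})" by (auto intro!: tendsto_eq_intros)
  have lim: "((\<lambda>s. C * norm (T \<bar>s - t\<bar> f - f)) \<longlongrightarrow> 0) (at t within {0..})"
    using tendsto_zero[OF abs0, of f] by (auto intro!: tendsto_eq_intros)
  have "\<forall>\<^sub>F s in at t within {0..}. norm (T s f - T t f) \<le> C * norm (T \<bar>s - t\<bar> f - f)"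
  proof (rule eventually_at_filter[THEN iffD2], rule always_eventually, intro allI impI)
    fix s assume "s \<noteq> t" "s \<in> {0..}"
    then have s: "0 \<le> s" by simp
    have "norm (T s f - T t f) = norm (T (min s t) (T \<bar>s - t\<bar> f - f))"
      using split_min[OF s t, of f 0] linear_diff[OF bounded_linear.linear[OF bounded_linear], of "min s t"] s t
      by simp
    also have "\<dots> \<le> C * norm (T \<bar>s - t\<bar> f - f)" using s t by (intro C) (auto simp: min_def)
    finally show "norm (T s f - T t f) \<le> C * norm (T \<bar>s - t\<bar> f - f)" .
  qed
  then have "((\<lambda>s. T s f - T t f) \<longlongrightarrow> 0) (at t within {0..})" using lim by (rule Lim_null_comparison)
  then show "((\<lambda>s. T s f) \<longlongrightarrow> T t f) (at t within {0..})" by (rule LIM_zero_cancel)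
qed

lemma invariant:
  assumes "(f, g) \<in> H" "0 \<le> t"
  shows "(T t f, T t g) \<in> H"
  unfolding gen
proof -
  interpret bounded_linear "T t" using assms(2) by (rule bounded_linear)
  have "((\<lambda>s. T t ((T s f - f) /\<^sub>R s)) \<longlongrightarrow> T t (- g)) (at_right 0)"
    using assms(1) unfolding gen by (rule tendsto)
  moreover have "\<forall>\<^sub>F s in at_right 0. T t ((T s f - f) /\<^sub>R s) = (T s (T t f) - T t f) /\<^sub>R s"
    unfolding eventually_at_filter
  proof (rule always_eventually, intro allI impI)
    fix s :: real assume "s \<in> {0<..}"
    then show "T t ((T s f - f) /\<^sub>R s) = (T s (T t f) - T t f) /\<^sub>R s"
      using add_time[of s t f] add_time[of t s f] assms(2) by (simp add: scaleR diff add.commute)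
  qed
  ultimately have "((\<lambda>s. (T s (T t f) - T t f) /\<^sub>R s) \<longlongrightarrow> T t (- g)) (at_right 0)"
    by (rule Lim_transform_eventually)
  then show "((\<lambda>s. (T s (T t f) - T t f) /\<^sub>R s) \<longlongrightarrow> - T t g) (at_right 0)" by (simp add: neg)
qed

text \<open>The generator supplies only a right derivative at 0. By \<open>split_min\<close> the
  difference quotients on either side of \<open>t\<close> are, up to sign,
  \<open>T (min s t)\<close> applied to a quotient at 0, and the local norm bound lets the limit
  pass through.\<close>

lemma has_derivative:
  assumes fg: "(f, g) \<in> H" and "0 < t"
  shows "((\<lambda>s. T s f) has_derivative (\<lambda>h. h *\<^sub>R (- T t g))) (at t)"
proof -
  have t: "0 \<le> t" using \<open>0 < t\<close> by simp
  obtain C where "0 \<le> C" and C: "\<And>r x. r \<in> {0..t + 1} \<Longrightarrow> norm (T r x) \<le> C * norm x"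
    using locally_bounded by blast
  let ?F = "at t within {0..}"
  have abs0: "((\<lambda>s. \<bar>s - t\<bar>) \<longlongrightarrow> 0) ?F" by (auto intro!: tendsto_eq_intros)
  have abspos: "\<forall>\<^sub>F s in ?F. \<bar>s - t\<bar> \<in> {0<..}" unfolding eventually_at_filter by simp
  have "filterlim (\<lambda>s. \<bar>s - t\<bar>) (at_right 0) ?F"
    unfolding filterlim_at using abs0 abspos by (auto elim: eventually_mono)
  then have q: "((\<lambda>s. (T \<bar>s - t\<bar> f - f) /\<^sub>R \<bar>s - t\<bar>) \<longlongrightarrow> - g) ?F"
    using fg unfolding gen by (rule filterlim_compose[rotated])
  have m: "((\<lambda>s. T (min s t) g) \<longlongrightarrow> T t g) ?F"
  proof -
    have "continuous_on {0..} (\<lambda>s. T (min s t) g)"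
      using t by (intro continuous_on_compose2[OF continuous] continuous_intros) auto
    then have "((\<lambda>s. T (min s t) g) \<longlongrightarrow> T (min t t) g) ?F"
      using t unfolding continuous_on_def by blast
    then show ?thesis by simp
  qed
  have "((\<lambda>s. C * norm ((T \<bar>s - t\<bar> f - f) /\<^sub>R \<bar>s - t\<bar> + g) + norm (T t g - T (min s t) g)) \<longlongrightarrow> C * norm (- g + g) + norm (T t g - T t g)) ?F"
    by (intro tendsto_intros q m)
  then have lim: "((\<lambda>s. C * norm ((T \<bar>s - t\<bar> f - f) /\<^sub>R \<bar>s - t\<bar> + g) + norm (T t g - T (min s t) g)) \<longlongrightarrow> 0) ?F"
    by simp
  have "\<forall>\<^sub>F s in ?F. norm (norm (T s f - T t f - (s - t) *\<^sub>R (- T t g)) / norm (s - t))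
      \<le> C * norm ((T \<bar>s - t\<bar> f - f) /\<^sub>R \<bar>s - t\<bar> + g) + norm (T t g - T (min s t) g)"
  proof (rule eventually_at_filter[THEN iffD2], rule always_eventually, intro allI impI)
    fix s assume "s \<noteq> t" "s \<in> {0..}"
    then have s: "0 \<le> s" and h: "0 < \<bar>s - t\<bar>" by auto
    interpret bounded_linear "T (min s t)" using s t by (intro bounded_linear) simp
    define h where "h = \<bar>s - t\<bar>"
    have "0 < h" using h by (simp add: h_def)
    define q where "q = (T h f - f) /\<^sub>R h"
    have hq: "T h f = h *\<^sub>R q + f" using \<open>0 < h\<close> by (simp add: q_def)
    have "norm (T s f - T t f - (s - t) *\<^sub>R (- T t g)) = norm (T (min s t) (T h f) - T (min s t) f + h *\<^sub>R T t g)"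
      using split_min[OF s t, of f "T t g"] by (simp add: h_def)
    \<comment> \<open>The correction \<open>T t g - T (min s t) g\<close> matters for
      \<open>s < t\<close> and tends to 0 by continuity of the orbit of \<open>g\<close>.\<close>
    also have "T (min s t) (T h f) - T (min s t) f + h *\<^sub>R T t g
        = h *\<^sub>R (T (min s t) (q + g) + (T t g - T (min s t) g))"
      by (simp add: hq add scaleR algebra_simps)
    also have "norm \<dots> \<le> h * (norm (T (min s t) (q + g)) + norm (T t g - T (min s t) g))"
      using \<open>0 < h\<close> by (simp add: norm_triangle_ineq)
    also have "norm (T (min s t) (q + g)) \<le> C * norm (q + g)" using s t by (intro C) (auto simp: min_def)
    finally have "norm (T s f - T t f - (s - t) *\<^sub>R (- T t g)) \<le> h * (C * norm (q + g) + norm (T t g - T (min s t) g))"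
      using \<open>0 < h\<close> by (simp add: mult_left_mono)
    then show "norm (norm (T s f - T t f - (s - t) *\<^sub>R (- T t g)) / norm (s - t))
        \<le> C * norm ((T \<bar>s - t\<bar> f - f) /\<^sub>R \<bar>s - t\<bar> + g) + norm (T t g - T (min s t) g)"
      using \<open>0 < h\<close> unfolding q_def h_def by (simp add: pos_divide_le_eq mult.commute)
  qed
  then have "((\<lambda>s. norm (T s f - T t f - (s - t) *\<^sub>R (- T t g)) / norm (s - t)) \<longlongrightarrow> 0) ?F"
    using lim by (rule Lim_null_comparison)
  then have "((\<lambda>s. T s f) has_derivative (\<lambda>h. h *\<^sub>R (- T t g))) ?F"
    unfolding has_derivative_iff_norm by (intro conjI bounded_linear_scaleR_left)
  moreover have "?F = at t" using \<open>0 < t\<close> by (intro at_within_interior) simp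
  ultimately show ?thesis by simp
qed

lemma closed_eq_UNIV: "closed S \<Longrightarrow> Domain H \<subseteq> S \<Longrightarrow> S = UNIV"
  using closure_minimal[of "Domain H" S] dense by auto

lemma T_continuous [continuous_intros]:
  "0 \<le> t \<Longrightarrow> continuous_on A \<phi> \<Longrightarrow> continuous_on A (\<lambda>x. T t (\<phi> x))"
  using bounded_linear.continuous_on[OF bounded_linear] .

text \<open>On the domain, \<open>exp (2 * m * s) * inner (T s f) (T s f)\<close> is nonincreasing
  in \<open>s\<close>: the lower bound applies to \<open>T s f\<close>, which stays in the domain.
  Density extends the estimate to all vectors.\<close>

lemma norm_le:
  assumes lower: "\<And>f g. (f, g) \<in> H \<Longrightarrow> m * (norm f)\<^sup>2 \<le> inner g f" and "0 < t"
  shows "norm (T t f) \<le> exp (- m * t) * norm f"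
proof -
  have t: "0 \<le> t" using assms(2) by simp
  have dom: "norm (T t f) \<le> exp (- m * t) * norm f" if fg: "(f, g) \<in> H" for f g
  proof -
    let ?p = "\<lambda>s. exp (2 * m * s) * inner (T s f) (T s f)"
    have "?p t \<le> ?p 0"
    proof (rule DERIV_nonpos_imp_decreasing_open[OF t])
      fix s assume "0 < s" "s < t"
      have "((\<lambda>s. inner (T s f) (T s f)) has_derivative
          (\<lambda>h. inner (T s f) (h *\<^sub>R (- T s g)) + inner (h *\<^sub>R (- T s g)) (T s f))) (at s)"
        by (intro has_derivative_inner has_derivative fg \<open>0 < s\<close>)
      then have "((\<lambda>s. inner (T s f) (T s f)) has_real_derivative - 2 * inner (T s g) (T s f)) (at s)"
        unfolding has_field_derivative_def
        by (rule has_derivative_eq_rhs) (auto simp: inner_commute fun_eq_iff)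
      then have "DERIV ?p s :> exp (2 * m * s) * (2 * m) * inner (T s f) (T s f)
          + - 2 * inner (T s g) (T s f) * exp (2 * m * s)"
        by (auto intro!: derivative_eq_intros)
      moreover have "m * inner (T s f) (T s f) \<le> inner (T s g) (T s f)"
        using lower[OF invariant[OF fg]] \<open>0 < s\<close> by (simp add: power2_norm_eq_inner)
      then have "exp (2 * m * s) * (2 * (m * inner (T s f) (T s f) - inner (T s g) (T s f))) \<le> 0"
        by (intro mult_nonneg_nonpos) auto
      ultimately show "\<exists>y. DERIV ?p s :> y \<and> y \<le> 0"
        by (intro exI[of _ "exp (2 * m * s) * (2 * m) * inner (T s f) (T s f) + - 2 * inner (T s g) (T s f) * exp (2 * m * s)"] conjI) (simp_all add: algebra_simps)
    next
      show "continuous_on {0..t} ?p"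
        by (intro continuous_intros continuous_on_subset[OF continuous]) auto
    qed
    then have "exp (2 * m * t) * (norm (T t f))\<^sup>2 \<le> (norm f)\<^sup>2"
      by (simp add: zero_time power2_norm_eq_inner)
    then have "(exp (m * t) * norm (T t f))\<^sup>2 \<le> (norm f)\<^sup>2"
      by (simp add: power_mult_distrib exp_double[symmetric] mult.assoc)
    then have "exp (m * t) * norm (T t f) \<le> norm f" by (rule power2_le_imp_le) simp
    then show ?thesis by (simp add: exp_minus field_simps)
  qed
  have "{f. norm (T t f) \<le> exp (- m * t) * norm f} = UNIV"
  proof (rule closed_eq_UNIV)
    show "closed {f. norm (T t f) \<le> exp (- m * t) * norm f}"
      using t by (intro closed_Collect_le continuous_intros)
  qed (use dom in auto)
  then show ?thesis by blast
qed

text \<open>On the domain, \<open>inner (T (t - s) f) (T s f')\<close> is constant in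
  \<open>s\<close>, since the two derivative terms cancel by symmetry of \<open>H\<close>; its
  endpoint values are the two sides. Density then frees one argument at a time.\<close>

lemma symmetric:
  assumes "0 < t"
  shows "inner (T t f) f' = inner f (T t f')"
proof -
  have t: "0 \<le> t" using assms by simp
  have dom: "inner (T t f) f' = inner f (T t f')" if fg: "(f, g) \<in> H" and fg': "(f', g') \<in> H" for f g f' g'
  proof -
    let ?p = "\<lambda>s. inner (T (t - s) f) (T s f')"
    have "?p t = ?p 0"
    proof (rule DERIV_isconst_end[OF assms])
      fix s assume s: "0 < s" "s < t"
      have "((\<lambda>s. T (t - s) f) has_derivative (\<lambda>h. (- h) *\<^sub>R (- T (t - s) g))) (at s)"
      proof (rule has_derivative_compose[of "\<lambda>s. t - s" uminus, where g = "\<lambda>s. T s f"])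
        show "((\<lambda>s. t - s) has_derivative uminus) (at s)" by (auto intro!: derivative_eq_intros)
        show "((\<lambda>s. T s f) has_derivative (\<lambda>h. h *\<^sub>R (- T (t - s) g))) (at (t - s))"
          using s by (intro has_derivative fg) simp
      qed
      then have "(?p has_derivative (\<lambda>h. inner (T (t - s) f) (h *\<^sub>R (- T s g'))
          + inner ((- h) *\<^sub>R (- T (t - s) g)) (T s f'))) (at s)"
        using s by (intro has_derivative_inner has_derivative fg')
      moreover have "inner (T (t - s) g) (T s f') = inner (T (t - s) f) (T s g')"
        using s by (intro symm invariant fg fg') auto
      ultimately show "DERIV ?p s :> 0"
        unfolding has_field_derivative_def
        by (elim has_derivative_eq_rhs) (auto simp: fun_eq_iff)
    next
      show "continuous_on {0..t} ?p"
        by (intro continuous_intros continuous_on_compose2[OF continuous]) auto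
    qed
    then show ?thesis by (simp add: zero_time)
  qed
  have 1: "inner (T t f) f' = inner f (T t f')" if fg': "(f', g') \<in> H" for f f' g'
  proof -
    have "{f. inner (T t f) f' = inner f (T t f')} = UNIV"
    proof (rule closed_eq_UNIV)
      show "closed {f. inner (T t f) f' = inner f (T t f')}"
        using t by (intro closed_Collect_eq continuous_intros)
    qed (use dom fg' in auto)
    then show ?thesis by blast
  qed
  have "{f'. inner (T t f) f' = inner f (T t f')} = UNIV"
  proof (rule closed_eq_UNIV)
    show "closed {f'. inner (T t f) f' = inner f (T t f')}"
      using t by (intro closed_Collect_eq continuous_intros)
  qed (use 1 in auto)
  then show ?thesis by blast
qed

text \<open>The form of \<open>T t\<close> is the squared norm of \<open>T (t / 2)\<close>, so halving the time repeatedly reduces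
  the claim to strong continuity at \<open>0\<close>.\<close>

lemma form_eq_zero:
  assumes "0 < t" "inner (T t f) f = 0"
  shows "f = 0"
proof -
  have half: "T (t / 2) f = 0" if "0 < t" "inner (T t f) f = 0" for t
  proof -
    have "inner (T (t / 2) f) (T (t / 2) f) = inner (T (t / 2) (T (t / 2) f)) f"
      using that symmetric[of "t / 2" f "T (t / 2) f"] by (simp add: inner_commute)
    then show ?thesis using that add_time[of "t / 2" "t / 2" f] by simp
  qed
  have z: "inner (T (t / 2 ^ n) f) f = 0" for n
  proof (induction n)
    case (Suc n)
    then show ?case using half[of "t / 2 ^ n"] assms(1) by (simp add: field_simps)
  qed (use assms in simp)
  have "(\<lambda>n. t / 2 ^ n) \<longlonglongrightarrow> 0" by real_asymp
  then have "(\<lambda>n. T (t / 2 ^ n) f) \<longlonglongrightarrow> f"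
    using assms(1) by (intro tendsto_zero) auto
  then have "(\<lambda>n. inner (T (t / 2 ^ n) f) f) \<longlonglongrightarrow> inner f f" by (intro tendsto_intros)
  then have "(\<lambda>n. 0) \<longlonglongrightarrow> inner f f" by (simp add: z)
  then have "inner f f = 0" by (rule LIMSEQ_unique[OF _ tendsto_const])
  then show ?thesis by simp
qed

end

section \<open>Transfer to operators on complex-valued functions\<close>

text \<open>The adjoint condition sees its arguments only through integrals. Hence a self-adjoint
  graph contains all representatives of its elements, and passing to classes loses nothing.\<close>

lemma adjoint_graph_cong_AE:
  assumes "(f, g) \<in> adjoint_graph N H" "H \<subseteq> L2 N \<times> L2 N" "f' \<in> L2 N" "g' \<in> L2 N"
    "AE x in N. f x = f' x" "AE x in N. g x = g' x"
  shows "(f', g') \<in> adjoint_graph N H"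
proof -
  have fg: "f \<in> L2 N" "g \<in> L2 N" and eq: "\<And>u v. (u, v) \<in> H \<Longrightarrow> L2_inner N v f = L2_inner N u g"
    using assms(1) by (auto simp: adjoint_graph_def)
  have "L2_inner N v f' = L2_inner N u g'" if "(u, v) \<in> H" for u v
  proof -
    have uv: "u \<in> L2 N" "v \<in> L2 N" using that assms(2) by auto
    have "L2_inner N v f' = L2_inner N v f"
      by (rule L2_inner_cong_AE) (use assms uv fg in \<open>auto elim: eventually_mono\<close>)
    also have "\<dots> = L2_inner N u g" by (rule eq) fact
    also have "\<dots> = L2_inner N u g'"
      by (rule L2_inner_cong_AE) (use assms uv fg in auto)
    finally show ?thesis .
  qed
  then show ?thesis using assms by (auto simp: adjoint_graph_def)
qed

lemma L2_inner_cmult_left: "L2_inner N (\<lambda>x. c * f x) g = c * L2_inner N f g"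
  by (simp add: L2_inner_def mult.assoc)

lemma L2_inner_cmult_right: "L2_inner N f (\<lambda>x. c * g x) = cnj c * L2_inner N f g"
  by (simp add: L2_inner_def mult.left_commute)

lemma adjoint_graph_cmult:
  "(f, g) \<in> adjoint_graph N H \<Longrightarrow> ((\<lambda>x. c * f x), (\<lambda>x. c * g x)) \<in> adjoint_graph N H"
  by (auto simp: adjoint_graph_def L2_cmult L2_inner_cmult_right)

text \<open>The complex structure as a real-linear skew isometry; it takes the role of
  \<open>J\<close> for non-real spectral parameters.\<close>

lift_definition imult_l2 :: "'a::euclidean_space l2 \<Rightarrow> 'a l2" is "\<lambda>f x. \<i> * f x"
  by (auto intro: L2_cmult)

lemma imult_abs_l2: "f \<in> L2 lborel \<Longrightarrow> imult_l2 (abs_l2 f) = abs_l2 (\<lambda>x. \<i> * f x)"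
  by (simp add: imult_l2.abs_eq)

lemma inner_abs_l2:
  "f \<in> L2 lborel \<Longrightarrow> g \<in> L2 lborel \<Longrightarrow> inner (abs_l2 f) (abs_l2 g) = Re (L2_inner lborel f g)"
  by (simp add: inner_l2.abs_eq)

lemma imult_l2_skew: "inner (imult_l2 F) G = - inner F (imult_l2 G)"
  by transfer (simp add: L2_inner_cmult_left L2_inner_cmult_right)

lemma bounded_linear_imult_l2: "bounded_linear imult_l2"
proof (rule bounded_linear_intro[where K = 1])
  fix F G :: "'a l2" and r :: real
  show "imult_l2 (F + G) = imult_l2 F + imult_l2 G"
    by transfer (auto intro!: L2_add L2_cmult simp: distrib_left)
  show "imult_l2 (r *\<^sub>R F) = r *\<^sub>R imult_l2 F"
    by transfer (auto intro!: L2_cmult)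
  have "inner (imult_l2 F) (imult_l2 F) = inner F F"
    by transfer (simp add: L2_inner_cmult_left L2_inner_cmult_right)
  then show "norm (imult_l2 F) \<le> norm F * 1" by (simp add: norm_eq_sqrt_inner)
qed

definition l2_graph :: "('a::euclidean_space \<Rightarrow> complex) rel \<Rightarrow> ('a l2 \<times> 'a l2) set" where
  "l2_graph H = (\<lambda>(f, g). (abs_l2 f, abs_l2 g)) ` H"

text \<open>Abstracts from the Feynman-Kac formula: the Hilbert space part concerns any semigroup
  generated by minus a self-adjoint relation bounded from below.\<close>

locale schroedinger_semigroup =
  fixes H :: "('a::euclidean_space \<Rightarrow> complex) rel" and T :: "real \<Rightarrow> ('a \<Rightarrow> complex) \<Rightarrow> 'a \<Rightarrow> complex"
  assumes sa: "self_adjoint lborel H" and lower: "bounded_from_below lborel H"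
    and exp: "is_exp_semigroup lborel T H"
begin

lemma H_L2: "(f, g) \<in> H \<Longrightarrow> f \<in> L2 lborel" "(f, g) \<in> H \<Longrightarrow> g \<in> L2 lborel"
  using sa by (auto simp: self_adjoint_def adjoint_graph_def)

lemma H_cong: "(f, g) \<in> H \<Longrightarrow> f' \<in> L2 lborel \<Longrightarrow> g' \<in> L2 lborel \<Longrightarrow>
    AE x in lborel. f x = f' x \<Longrightarrow> AE x in lborel. g x = g' x \<Longrightarrow> (f', g') \<in> H"
proof -
  have "adjoint_graph lborel H = H" "H \<subseteq> L2 lborel \<times> L2 lborel"
    using sa H_L2 by (auto simp: self_adjoint_def)
  then show "(f, g) \<in> H \<Longrightarrow> f' \<in> L2 lborel \<Longrightarrow> g' \<in> L2 lborel \<Longrightarrow>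
    AE x in lborel. f x = f' x \<Longrightarrow> AE x in lborel. g x = g' x \<Longrightarrow> (f', g') \<in> H"
    using adjoint_graph_cong_AE[of f g lborel H f' g'] by simp
qed

lemma abs_l2_graph_iff:
  assumes "f \<in> L2 lborel" "g \<in> L2 lborel"
  shows "(abs_l2 f, abs_l2 g) \<in> l2_graph H \<longleftrightarrow> (f, g) \<in> H"
proof
  assume "(abs_l2 f, abs_l2 g) \<in> l2_graph H"
  then obtain f' g' where "(f', g') \<in> H" "abs_l2 f' = abs_l2 f" "abs_l2 g' = abs_l2 g"
    by (auto simp: l2_graph_def)
  then show "(f, g) \<in> H" using H_cong[of f' g' f g] H_L2 assms by (simp add: abs_l2_eq_iff)
qed (force simp: l2_graph_def)

lemma l2_graphE:
  assumes "(F, G) \<in> l2_graph H"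
  obtains f g where "F = abs_l2 f" "G = abs_l2 g" "(f, g) \<in> H" "f \<in> L2 lborel" "g \<in> L2 lborel"
  using assms H_L2 by (auto simp: l2_graph_def)

text \<open>Real self-adjointness implies nothing weaker than the complex one because
  \<open>H\<close> is closed under multiplication by the imaginary unit: the real identity for the
  multiplied pairs is the identity of imaginary parts.\<close>

lemma l2_graph_self_adjoint: "l2_graph H = {(U, V). \<forall>(F, G)\<in>l2_graph H. inner G U = inner F V}"
proof (intro set_eqI iffI; clarify)
  fix U V F G assume "(U, V) \<in> l2_graph H" "(F, G) \<in> l2_graph H"
  then obtain u v f g where uv: "U = abs_l2 u" "V = abs_l2 v" "(u, v) \<in> H" "u \<in> L2 lborel" "v \<in> L2 lborel"
    and fg: "F = abs_l2 f" "G = abs_l2 g" "(f, g) \<in> H" "f \<in> L2 lborel" "g \<in> L2 lborel"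
    by (metis l2_graphE)
  have "L2_inner lborel g u = L2_inner lborel f v"
    using sa uv fg unfolding self_adjoint_def adjoint_graph_def by blast
  then show "inner G U = inner F V" using uv fg by (simp add: inner_abs_l2)
next
  fix U V assume *: "\<forall>(F, G)\<in>l2_graph H. inner G U = inner F V"
  define u v where "u = rep_l2 U" and "v = rep_l2 V"
  have uv: "U = abs_l2 u" "V = abs_l2 v" "u \<in> L2 lborel" "v \<in> L2 lborel" by (simp_all add: u_def v_def)
  have re: "Re (L2_inner lborel g u) = Re (L2_inner lborel f v)" if "(f, g) \<in> H" for f g
  proof -
    have "f \<in> L2 lborel" "g \<in> L2 lborel" "(abs_l2 f, abs_l2 g) \<in> l2_graph H"
      using that H_L2 by (auto simp: l2_graph_def)
    then show ?thesis using * uv by (auto simp: inner_abs_l2)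
  qed
  have "L2_inner lborel g u = L2_inner lborel f v" if fg: "(f, g) \<in> H" for f g
  proof -
    have "((\<lambda>x. \<i> * f x), (\<lambda>x. \<i> * g x)) \<in> H"
      using adjoint_graph_cmult[of f g lborel H \<i>] sa fg by (simp add: self_adjoint_def)
    from re[OF this] re[OF fg] show ?thesis by (simp add: L2_inner_cmult_left complex_eq_iff)
  qed
  then have "(u, v) \<in> adjoint_graph lborel H" using uv by (auto simp: adjoint_graph_def)
  then have "(u, v) \<in> H" using sa by (simp add: self_adjoint_def)
  then show "(U, V) \<in> l2_graph H" using uv by (simp add: abs_l2_graph_iff)
qed

section \<open>Resolvent set, spectrum and the ground state energy\<close>

lemma lower_l2: "\<exists>c. \<forall>F G. (F, G) \<in> l2_graph H \<longrightarrow> c * (norm F)\<^sup>2 \<le> inner G F"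
proof -
  obtain c where c: "\<And>f g. (f, g) \<in> H \<Longrightarrow> c * (L2_norm lborel f)\<^sup>2 \<le> Re (L2_inner lborel g f)"
    using lower by (auto simp: bounded_from_below_def)
  have "c * (norm F)\<^sup>2 \<le> inner G F" if "(F, G) \<in> l2_graph H" for F G
    using that by (rule l2_graphE) (use c in \<open>auto simp: norm_abs_l2 inner_abs_l2\<close>)
  then show ?thesis by blast
qed

text \<open>Splits a complex spectral parameter into a real shift and a skew part, the shape of
  \<open>self_adjoint_resolvent_surj\<close>.\<close>

lemma resolvent_abs_l2:
  assumes "f \<in> L2 lborel" "g \<in> L2 lborel"
  shows "abs_l2 (\<lambda>x. g x - z * f x) = abs_l2 g - Re z *\<^sub>R abs_l2 f - Im z *\<^sub>R imult_l2 (abs_l2 f)"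
proof -
  have "(\<lambda>x. g x - z * f x) = (\<lambda>x. (g x - of_real (Re z) * f x) - of_real (Im z) * (\<i> * f x))"
    by (auto simp: fun_eq_iff complex_eq_iff algebra_simps)
  then show ?thesis
    using assms by (simp add: abs_l2_diff L2_cmult L2_diff abs_l2_scaleR imult_abs_l2)
qed

lemma resolvent_setI:
  assumes surj: "\<And>K. \<exists>(F, G)\<in>l2_graph H. G - Re z *\<^sub>R F - Im z *\<^sub>R imult_l2 F = K"
    and bd: "\<And>F G. (F, G) \<in> l2_graph H \<Longrightarrow> norm F \<le> C * norm (G - Re z *\<^sub>R F - Im z *\<^sub>R imult_l2 F)"
  shows "z \<in> resolvent_set lborel H"
  unfolding resolvent_set_def
proof (intro CollectI conjI exI[of _ C] ballI)
  fix h :: "'a \<Rightarrow> complex" assume h: "h \<in> L2 lborel"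
  obtain F G where FG: "(F, G) \<in> l2_graph H" and eq: "G - Re z *\<^sub>R F - Im z *\<^sub>R imult_l2 F = abs_l2 h"
    using surj[of "abs_l2 h"] by blast
  obtain f g where fg: "F = abs_l2 f" "G = abs_l2 g" "(f, g) \<in> H" "f \<in> L2 lborel" "g \<in> L2 lborel"
    using FG by (rule l2_graphE)
  have "abs_l2 (\<lambda>x. g x - z * f x) = abs_l2 h" using eq fg by (simp add: resolvent_abs_l2)
  then have "AE x in lborel. g x - z * f x = h x"
    using fg h by (simp add: abs_l2_eq_iff L2_cmult L2_diff)
  then show "\<exists>(f, g)\<in>H. AE x in lborel. g x - z * f x = h x" using fg by blast
next
  fix p assume "p \<in> H"
  then obtain f g where p: "p = (f, g)" "(f, g) \<in> H" by (cases p) auto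
  then have fg: "f \<in> L2 lborel" "g \<in> L2 lborel" "(abs_l2 f, abs_l2 g) \<in> l2_graph H"
    using H_L2 by (auto simp: l2_graph_def)
  show "case p of (f, g) \<Rightarrow> L2_norm lborel f \<le> C * L2_norm lborel (\<lambda>x. g x - z * f x)"
    using bd[OF fg(3)] fg p
    by (simp add: norm_abs_l2 L2_cmult L2_diff flip: resolvent_abs_l2)
qed

text \<open>The open half-plane to the left of a lower bound of the form is free of spectrum;
  surjectivity comes from coercivity, and pairing with \<open>F\<close> removes the skew term from
  the norm estimate.\<close>

lemma resolvent_set_left:
  assumes c: "\<And>F G. (F, G) \<in> l2_graph H \<Longrightarrow> c * (norm F)\<^sup>2 \<le> inner G F" and z: "Re z < c"
  shows "z \<in> resolvent_set lborel H"
proof (rule resolvent_setI)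
  show "\<exists>(F, G)\<in>l2_graph H. G - Re z *\<^sub>R F - Im z *\<^sub>R imult_l2 F = K" for K
    by (rule self_adjoint_resolvent_surj[OF l2_graph_self_adjoint c bounded_linear_imult_l2 imult_l2_skew z])
  show "norm F \<le> (1 / (c - Re z)) * norm (G - Re z *\<^sub>R F - Im z *\<^sub>R imult_l2 F)"
    if "(F, G) \<in> l2_graph H" for F G
  proof (cases "F = 0")
    case False
    let ?K = "G - Re z *\<^sub>R F - Im z *\<^sub>R imult_l2 F"
    have "inner (imult_l2 F) F = 0" using imult_l2_skew[of F F] by (simp add: inner_commute)
    then have "(c - Re z) * (norm F)\<^sup>2 \<le> inner ?K F"
      using c[OF that] by (simp add: inner_diff_left power2_norm_eq_inner algebra_simps)
    also have "\<dots> \<le> norm ?K * norm F" by (rule norm_cauchy_schwarz)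
    finally have "(c - Re z) * norm F \<le> norm ?K" using False by (simp add: power2_eq_square)
    then show ?thesis using z by (simp add: field_simps)
  qed (use z in simp)
qed

text \<open>The infimum \<open>b\<close> of the numerical range lies in the spectrum, so
  \<open>E0\<close> is at most \<open>b\<close>.\<close>

lemma lower_bound_ground_state:
  assumes "ground_state_exists_at lborel H E0" and FG: "(F, G) \<in> l2_graph H"
  shows "E0 * (norm F)\<^sup>2 \<le> inner G F"
proof -
  obtain c where c: "\<And>F G. (F, G) \<in> l2_graph H \<Longrightarrow> c * (norm F)\<^sup>2 \<le> inner G F" using lower_l2 by blast
  \<comment> \<open>Without a lower bound for this set, its infimum in the reals would be an
    unspecified value.\<close>
  have bdd: "bdd_below (Re ` spectrum lborel H)"
    using resolvent_set_left[OF c] unfolding spectrum_def by (intro bdd_belowI[of _ c]) force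
  \<comment> \<open>The ground state serves as the nonzero vector in the domain.\<close>
  obtain f g where fg: "(f, g) \<in> H" "\<not> (AE x in lborel. f x = 0)"
    using assms(1) by (auto simp: ground_state_exists_at_def eigenvalue_def)
  have "f \<in> L2 lborel" using fg H_L2 by blast
  then have "abs_l2 f \<noteq> 0" using fg(2) by (simp add: zero_l2_def abs_l2_eq_iff)
  moreover have "(abs_l2 f, abs_l2 g) \<in> l2_graph H" using fg by (force simp: l2_graph_def)
  ultimately obtain b where b: "\<And>F G. (F, G) \<in> l2_graph H \<Longrightarrow> b * (norm F)\<^sup>2 \<le> inner G F"
    and spec: "\<And>C. (\<And>K. \<exists>(F, G)\<in>l2_graph H. G - b *\<^sub>R F = K) \<Longrightarrow>
       (\<And>F G. (F, G) \<in> l2_graph H \<Longrightarrow> norm F \<le> C * norm (G - b *\<^sub>R F)) \<Longrightarrow> False"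
    using self_adjoint_lower_bound_spectral[OF l2_graph_self_adjoint c] by metis
  have "of_real b \<in> spectrum lborel H"
  proof -
    have False if res: "of_real b \<in> resolvent_set lborel H"
    proof -
      obtain C where C: "\<And>f g. (f, g) \<in> H \<Longrightarrow> L2_norm lborel f \<le> C * L2_norm lborel (\<lambda>x. g x - of_real b * f x)"
        and surj: "\<And>h. h \<in> L2 lborel \<Longrightarrow> \<exists>(f, g)\<in>H. AE x in lborel. g x - of_real b * f x = h x"
        using res unfolding resolvent_set_def by blast
      show False
      proof (rule spec[of C])
        fix K
        obtain f g where fg: "(f, g) \<in> H" "AE x in lborel. g x - of_real b * f x = rep_l2 K x"
          using surj[of "rep_l2 K"] by auto
        then have L: "f \<in> L2 lborel" "g \<in> L2 lborel" using H_L2 by auto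
        have "abs_l2 (\<lambda>x. g x - of_real b * f x) = abs_l2 (rep_l2 K)"
          using L fg(2) by (subst abs_l2_eq_iff) (auto simp: L2_cmult L2_diff)
        then have "abs_l2 g - b *\<^sub>R abs_l2 f = K"
          using resolvent_abs_l2[OF L, of "of_real b"] by simp
        then show "\<exists>(F, G)\<in>l2_graph H. G - b *\<^sub>R F = K"
          using fg(1) L by (intro bexI[of _ "(abs_l2 f, abs_l2 g)"]) (auto simp: abs_l2_graph_iff)
      next
        fix F G assume "(F, G) \<in> l2_graph H"
        then obtain f g where fg: "F = abs_l2 f" "G = abs_l2 g" "(f, g) \<in> H" "f \<in> L2 lborel" "g \<in> L2 lborel"
          by (rule l2_graphE)
        show "norm F \<le> C * norm (G - b *\<^sub>R F)"
          using C[OF fg(3)] fg resolvent_abs_l2[OF fg(4,5), of "of_real b"]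
          by (simp add: norm_abs_l2[symmetric] L2_cmult L2_diff)
      qed
    qed
    then show ?thesis by (auto simp: spectrum_def)
  qed
  then have "Re (of_real b) \<in> Re ` spectrum lborel H" by (rule imageI)
  then have "E0 \<le> b"
    using cInf_lower[OF _ bdd, of b] assms(1) by (simp add: ground_state_exists_at_def)
  then have "E0 * (norm F)\<^sup>2 \<le> b * (norm F)\<^sup>2" by (intro mult_right_mono) auto
  then show ?thesis using b[OF FG] by simp
qed

section \<open>The semigroup on equivalence classes\<close>

lemma T_L2: "0 \<le> t \<Longrightarrow> f \<in> L2 lborel \<Longrightarrow> T t f \<in> L2 lborel"
  using exp by (auto simp: is_exp_semigroup_def strongly_continuous_semigroup_def)

lemma T_add: "0 \<le> t \<Longrightarrow> f \<in> L2 lborel \<Longrightarrow> g \<in> L2 lborel \<Longrightarrow>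
    AE x in lborel. T t (\<lambda>y. f y + g y) x = T t f x + T t g x"
  using exp by (auto simp: is_exp_semigroup_def strongly_continuous_semigroup_def)

lemma T_bound: "0 \<le> t \<Longrightarrow> \<exists>C. \<forall>f\<in>L2 lborel. L2_norm lborel (T t f) \<le> C * L2_norm lborel f"
  using exp by (auto simp: is_exp_semigroup_def strongly_continuous_semigroup_def)

definition l2_semigroup :: "real \<Rightarrow> 'a l2 \<Rightarrow> 'a l2" where
  "l2_semigroup t F = abs_l2 (T t (rep_l2 F))"

text \<open>\<open>T t\<close> acts on representatives and is not assumed to respect almost
  everywhere equality. This follows from additivity and the norm bound, applied to a difference
  \<open>d\<close> of norm zero.\<close>

lemma l2_semigroup_abs:
  assumes t: "0 \<le> t" and f: "f \<in> L2 lborel"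
  shows "l2_semigroup t (abs_l2 f) = abs_l2 (T t f)"
proof -
  define g where "g = rep_l2 (abs_l2 f)"
  have g: "g \<in> L2 lborel" by (simp add: g_def)
  have ae: "AE x in lborel. g x = f x" unfolding g_def by (rule rep_abs_l2[OF f])
  define d where "d = (\<lambda>x. g x - f x)"
  have d: "d \<in> L2 lborel" unfolding d_def by (rule L2_diff[OF g f])
  obtain C where "L2_norm lborel (T t d) \<le> C * L2_norm lborel d" using T_bound[OF t] d by blast
  moreover have "abs_l2 d = 0" unfolding d_def using ae f g by (simp add: abs_l2_diff abs_l2_eq_iff)
  ultimately have "norm (abs_l2 (T t d)) \<le> 0"
    using norm_abs_l2[OF d] norm_abs_l2[OF T_L2[OF t d]] by simp
  moreover have "abs_l2 (T t (\<lambda>y. f y + d y)) = abs_l2 (\<lambda>y. T t f y + T t d y)"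
    using T_add[OF t f d] t f d by (subst abs_l2_eq_iff) (auto intro!: T_L2 L2_add)
  moreover have "(\<lambda>y. f y + d y) = g" by (simp add: d_def)
  ultimately show ?thesis
    unfolding l2_semigroup_def g_def[symmetric] using t f d by (simp add: abs_l2_add T_L2)
qed

lemma l2_symmetric_semigroup: "symmetric_semigroup l2_semigroup (l2_graph H)"
proof (rule symmetric_semigroup.intro)
  fix t :: real assume t: "0 \<le> t"
  obtain C where C: "\<And>f. f \<in> L2 lborel \<Longrightarrow> L2_norm lborel (T t f) \<le> C * L2_norm lborel f"
    using T_bound[OF t] by blast
  show "bounded_linear (l2_semigroup t)"
  proof (rule bounded_linear_intro[where K = C])
    fix F G :: "'a l2" and r :: real
    define f g where "f = rep_l2 F" and "g = rep_l2 G"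
    have F: "F = abs_l2 f" "f \<in> L2 lborel" and G: "G = abs_l2 g" "g \<in> L2 lborel" by (simp_all add: f_def g_def)
    have "abs_l2 (T t (\<lambda>y. f y + g y)) = abs_l2 (\<lambda>y. T t f y + T t g y)"
      using T_add[OF t F(2) G(2)] t F G by (subst abs_l2_eq_iff) (auto intro!: T_L2 L2_add)
    then show "l2_semigroup t (F + G) = l2_semigroup t F + l2_semigroup t G"
      using t F G by (simp add: l2_semigroup_abs T_L2 L2_add flip: abs_l2_add)
    have "AE x in lborel. T t (\<lambda>y. of_real r * f y) x = of_real r * T t f x"
      using exp t F by (auto simp: is_exp_semigroup_def strongly_continuous_semigroup_def)
    then have "abs_l2 (T t (\<lambda>y. of_real r * f y)) = abs_l2 (\<lambda>y. of_real r * T t f y)"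
      using t F by (subst abs_l2_eq_iff) (auto intro!: T_L2 L2_cmult)
    then show "l2_semigroup t (r *\<^sub>R F) = r *\<^sub>R l2_semigroup t F"
      using t F by (simp add: l2_semigroup_abs T_L2 L2_cmult flip: abs_l2_scaleR)
    show "norm (l2_semigroup t F) \<le> norm F * C"
      using C[OF F(2)] t F by (simp add: l2_semigroup_abs norm_abs_l2 T_L2 mult.commute)
  qed
next
  fix F :: "'a l2"
  define f where "f = rep_l2 F"
  have F: "F = abs_l2 f" "f \<in> L2 lborel" by (simp_all add: f_def)
  have "AE x in lborel. T 0 f x = f x"
    using exp F by (auto simp: is_exp_semigroup_def strongly_continuous_semigroup_def)
  then show "l2_semigroup 0 F = F" using F by (simp add: l2_semigroup_abs abs_l2_eq_iff T_L2)
  show "l2_semigroup (s + t) F = l2_semigroup s (l2_semigroup t F)" if "0 \<le> s" "0 \<le> t" for s t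
  proof -
    have "AE x in lborel. T (s + t) f x = T s (T t f) x"
      using exp F that by (auto simp: is_exp_semigroup_def strongly_continuous_semigroup_def)
    then show ?thesis using F that by (simp add: l2_semigroup_abs abs_l2_eq_iff T_L2)
  qed
  have "((\<lambda>t. L2_norm lborel (\<lambda>x. T t f x - f x)) \<longlongrightarrow> 0) (at_right 0)"
    using exp F by (auto simp: is_exp_semigroup_def strongly_continuous_semigroup_def)
  moreover have "\<forall>\<^sub>F t in at_right 0. L2_norm lborel (\<lambda>x. T t f x - f x) = norm (l2_semigroup t F - F)"
    unfolding eventually_at_filter
    by (rule always_eventually)
      (use F in \<open>auto simp: l2_semigroup_abs T_L2 L2_diff norm_abs_l2 simp flip: abs_l2_diff\<close>)
  ultimately have "((\<lambda>t. norm (l2_semigroup t F - F)) \<longlongrightarrow> 0) (at_right 0)" by (rule Lim_transform_eventually)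
  then show "((\<lambda>t. l2_semigroup t F) \<longlongrightarrow> F) (at_right 0)"
    by (rule LIM_zero_cancel[OF tendsto_norm_zero_cancel])
  fix G :: "'a l2"
  define g where "g = rep_l2 G"
  have G: "G = abs_l2 g" "g \<in> L2 lborel" by (simp_all add: g_def)
  have gen: "generator lborel T = (\<lambda>(f, g). (f, \<lambda>x. - g x)) ` H"
    using exp by (simp add: is_exp_semigroup_def)
  \<comment> \<open>Negating the second component is injective, so membership in the generator can
    be read back as membership in \<open>H\<close>.\<close>
  have "(f, \<lambda>x. - g x) \<in> (\<lambda>(f, g). (f, \<lambda>x. - g x)) ` H \<longleftrightarrow> (f, g) \<in> H"
  proof
    assume "(f, \<lambda>x. - g x) \<in> (\<lambda>(f, g). (f, \<lambda>x. - g x)) ` H"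
    then obtain g' where g': "(f, g') \<in> H" "(\<lambda>x. - g x) = (\<lambda>x. - g' x)" by auto
    have "g x = g' x" for x using fun_cong[OF g'(2), of x] by simp
    then have "g = g'" by blast
    then show "(f, g) \<in> H" using g' by simp
  qed (auto intro: rev_image_eqI)
  then have "(F, G) \<in> l2_graph H \<longleftrightarrow> (f, \<lambda>x. - g x) \<in> generator lborel T"
    unfolding gen using F G by (simp add: abs_l2_graph_iff)
  also have "\<dots> \<longleftrightarrow> ((\<lambda>t. L2_norm lborel (\<lambda>x. (T t f x - f x) / of_real t - - g x)) \<longlongrightarrow> 0) (at_right 0)"
    using F G by (simp add: generator_def L2_uminus)
  also have "\<dots> \<longleftrightarrow> ((\<lambda>t. norm ((l2_semigroup t F - F) /\<^sub>R t - - G)) \<longlongrightarrow> 0) (at_right 0)"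
  proof (rule filterlim_cong[OF refl refl], unfold eventually_at_filter, rule always_eventually, intro allI impI)
    fix t :: real assume "t \<in> {0<..}"
    then have t: "0 \<le> t" by simp
    have eq: "(\<lambda>x. (T t f x - f x) / of_real t - - g x) = (\<lambda>x. of_real (inverse t) * (T t f x - f x) - - g x)"
      by (simp add: divide_inverse mult.commute)
    have *: "abs_l2 (\<lambda>x. (T t f x - f x) / of_real t - - g x) = (l2_semigroup t F - F) /\<^sub>R t - - G"
      unfolding eq using t F G by (simp only: l2_semigroup_abs T_L2 L2_diff L2_uminus L2_cmult abs_l2_diff abs_l2_scaleR abs_l2_uminus)
    have "(\<lambda>x. (T t f x - f x) / of_real t - - g x) \<in> L2 lborel"
      using t F G L2_cmult[OF L2_diff[OF T_L2[OF t F(2)] F(2)], of "inverse (of_real t)"]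
      by (intro L2_diff L2_uminus) (simp_all add: divide_inverse mult.commute)
    then show "L2_norm lborel (\<lambda>x. (T t f x - f x) / of_real t - - g x) = norm ((l2_semigroup t F - F) /\<^sub>R t - - G)"
      unfolding *[symmetric] by (rule norm_abs_l2[symmetric])
  qed
  also have "\<dots> \<longleftrightarrow> ((\<lambda>t. (l2_semigroup t F - F) /\<^sub>R t) \<longlongrightarrow> - G) (at_right 0)"
    by (simp only: tendsto_norm_zero_iff LIM_zero_iff)
  finally show "(F, G) \<in> l2_graph H \<longleftrightarrow> ((\<lambda>t. (l2_semigroup t F - F) /\<^sub>R t) \<longlongrightarrow> - G) (at_right 0)" .
next
  fix F G F' G' assume "(F, G) \<in> l2_graph H" "(F', G') \<in> l2_graph H"
  then show "inner G F' = inner F G'" using l2_graph_self_adjoint by blast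
next
  have "U \<in> closure (Domain (l2_graph H))" for U
    unfolding closure_approachable
  proof (intro allI impI)
    fix e :: real assume "0 < e"
    define u where "u = rep_l2 U"
    have U: "U = abs_l2 u" "u \<in> L2 lborel" by (simp_all add: u_def)
    obtain f g where fg: "(f, g) \<in> H" "L2_norm lborel (\<lambda>x. f x - u x) < e"
      using sa U \<open>0 < e\<close> unfolding self_adjoint_def densely_defined_def by blast
    then have "dist (abs_l2 f) U < e"
      using U H_L2[OF fg(1)] by (simp add: dist_norm norm_abs_l2 L2_diff flip: abs_l2_diff)
    moreover have "abs_l2 f \<in> Domain (l2_graph H)" using fg by (force simp: l2_graph_def)
    ultimately show "\<exists>F\<in>Domain (l2_graph H). dist F U < e" by blast
  qed
  then show "closure (Domain (l2_graph H)) = UNIV" by blast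
qed

sublocale l2: symmetric_semigroup l2_semigroup "l2_graph H"
  by (rule l2_symmetric_semigroup)

lemma form_le:
  assumes "ground_state_exists_at lborel H E0" "0 < t" and f: "f \<in> L2 lborel"
  shows "Re (L2_inner lborel (T t f) f) \<le> exp (- E0 * t) * (\<integral>x. (cmod (f x))\<^sup>2 \<partial>lborel)"
proof -
  have t: "0 \<le> t" using assms by simp
  have "Re (L2_inner lborel (T t f) f) = inner (l2_semigroup t (abs_l2 f)) (abs_l2 f)"
    using t f by (simp add: l2_semigroup_abs inner_abs_l2 T_L2)
  also have "\<dots> \<le> norm (l2_semigroup t (abs_l2 f)) * norm (abs_l2 f)" by (rule norm_cauchy_schwarz)
  also have "\<dots> \<le> exp (- E0 * t) * norm (abs_l2 f) * norm (abs_l2 f)"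
    using l2.norm_le[OF lower_bound_ground_state[OF assms(1)] assms(2)] by (intro mult_right_mono) auto
  also have "\<dots> = exp (- E0 * t) * (norm (abs_l2 f))\<^sup>2" by (simp add: power2_eq_square)
  also have "(norm (abs_l2 f))\<^sup>2 = (\<integral>x. (cmod (f x))\<^sup>2 \<partial>lborel)"
    using f by (simp add: norm_abs_l2 L2_norm_def)
  finally show ?thesis .
qed

lemma form_eq_zero_AE:
  assumes "0 < t" and f: "f \<in> L2 lborel" and "Re (L2_inner lborel (T t f) f) = 0"
  shows "AE x in lborel. f x = 0"
proof -
  have "inner (l2_semigroup t (abs_l2 f)) (abs_l2 f) = 0"
    using assms by (simp add: l2_semigroup_abs inner_abs_l2 T_L2)
  then have "abs_l2 f = 0" by (rule l2.form_eq_zero[OF assms(1)])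
  then show ?thesis using f by (simp add: zero_l2_def abs_l2_eq_iff)
qed

end

section \<open>Path integrals\<close>

lemma (in complete_measure) measurable_cong_AE_complete:
  assumes g: "g \<in> measurable M N" and ae: "AE x in M. f x = g x" and f: "f \<in> space M \<rightarrow> space N"
  shows "f \<in> measurable M N"
proof (rule measurableI)
  fix A assume A: "A \<in> sets N"
  show "f -` A \<inter> space M \<in> sets M"
  proof (rule in_sets_AE)
    show "AE x in M. (x \<in> g -` A \<inter> space M) = (x \<in> f -` A \<inter> space M)" using ae by eventually_elim auto
    show "g -` A \<inter> space M \<in> sets M" using g A by (rule measurable_sets)
  qed auto
qed (use f in auto)

text \<open>Measurability is given for each fixed time only. Joint measurability makes paths
  measurable in time and path integrals measurable in \<open>\<omega>\<close>.\<close>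

lemma cadlag_jointly_measurable_version:
  fixes X :: "real \<Rightarrow> 'w \<Rightarrow> 'a::euclidean_space"
  assumes X: "\<And>t. 0 \<le> t \<Longrightarrow> X t \<in> borel_measurable M" and cad: "AE \<omega> in M. cadlag (\<lambda>t. X t \<omega>)"
  obtains Y where "(\<lambda>(s, \<omega>). Y s \<omega>) \<in> borel_measurable (lborel \<Otimes>\<^sub>M M)"
    "AE \<omega> in M. \<forall>s\<ge>0. Y s \<omega> = X s \<omega>"
proof
  \<comment> \<open>For nonnegative \<open>s\<close> this is the first multiple of
    \<open>1 / Suc n\<close> strictly above \<open>s\<close>. The added 1 keeps it off
    \<open>s\<close>, so that right continuity applies; only countably many values occur.\<close>
  define d where "d n s = (real (nat \<lfloor>real (Suc n) * s\<rfloor>) + 1) / real (Suc n)" for n s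
  define Y where "Y s \<omega> = lim (\<lambda>n. X (d n s) \<omega>)" for s \<omega>
  have [measurable]: "(\<lambda>p. X (d n (fst p)) (snd p)) \<in> borel_measurable (lborel \<Otimes>\<^sub>M M)" for n
    unfolding d_def
  proof (rule measurable_compose_countable[where g = "\<lambda>p. nat \<lfloor>real (Suc n) * fst p\<rfloor>"
        and f = "\<lambda>i p. X ((real i + 1) / real (Suc n)) (snd p)"])
    show "(\<lambda>p. X ((real i + 1) / real (Suc n)) (snd p)) \<in> borel_measurable (lborel \<Otimes>\<^sub>M M)" for i
      by (rule measurable_compose[OF measurable_snd X]) simp
  qed measurable
  have "(\<lambda>p. lim (\<lambda>n. X (d n (fst p)) (snd p))) \<in> borel_measurable (lborel \<Otimes>\<^sub>M M)" by measurable
  then show "(\<lambda>(s, \<omega>). Y s \<omega>) \<in> borel_measurable (lborel \<Otimes>\<^sub>M M)"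
    by (simp add: Y_def case_prod_unfold)
  have d: "s < d n s" "d n s \<le> s + 1 / real (Suc n)" if "0 \<le> s" for n s
  proof -
    have *: "0 \<le> \<lfloor>real (Suc n) * s\<rfloor>" using that by simp
    have "real (Suc n) * s < real (nat \<lfloor>real (Suc n) * s\<rfloor>) + 1"
      using * real_of_int_floor_add_one_gt[of "real (Suc n) * s"] by simp
    then show "s < d n s" by (simp add: d_def field_simps)
    have "real (nat \<lfloor>real (Suc n) * s\<rfloor>) \<le> real (Suc n) * s" using * by simp
    then have "real (nat \<lfloor>real (Suc n) * s\<rfloor>) / real (Suc n) \<le> s"
      by (subst pos_divide_le_eq) (simp_all add: mult.commute)
    then show "d n s \<le> s + 1 / real (Suc n)" by (simp only: d_def add_divide_distrib add_right_mono)
  qed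
  show "AE \<omega> in M. \<forall>s\<ge>0. Y s \<omega> = X s \<omega>"
    using cad
  proof eventually_elim
    fix \<omega> assume w: "cadlag (\<lambda>t. X t \<omega>)"
    show "\<forall>s\<ge>0. Y s \<omega> = X s \<omega>"
    proof (intro allI impI)
      fix s :: real assume s: "0 \<le> s"
      have "(\<lambda>n. d n s) \<longlonglongrightarrow> s"
      proof (rule real_tendsto_sandwich[OF _ _ tendsto_const])
        show "\<forall>\<^sub>F n in sequentially. s \<le> d n s" using d(1)[OF s] by (intro always_eventually allI less_imp_le)
        show "\<forall>\<^sub>F n in sequentially. d n s \<le> s + 1 / real (Suc n)" using d(2)[OF s] by (intro always_eventually allI)
        show "(\<lambda>n. s + 1 / real (Suc n)) \<longlonglongrightarrow> s"
          using tendsto_add[OF tendsto_const LIMSEQ_inverse_real_of_nat, of s] by (simp add: inverse_eq_divide)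
      qed
      then have "filterlim (\<lambda>n. d n s) (at_right s) sequentially"
        unfolding filterlim_at using d(1)[OF s] by (auto simp: less_imp_neq[THEN not_sym])
      moreover have "((\<lambda>t. X t \<omega>) \<longlongrightarrow> X s \<omega>) (at_right s)"
        using w s by (simp add: cadlag_def continuous_within)
      ultimately have "(\<lambda>n. X (d n s) \<omega>) \<longlonglongrightarrow> X s \<omega>" by (rule filterlim_compose[rotated])
      then show "Y s \<omega> = X s \<omega>" unfolding Y_def by (rule limI)
    qed
  qed
qed

text \<open>For small \<open>t\<close> the expected path integral is below 1 uniformly in the
  starting point (any finite bound would serve), and finite expectation forces almost sure
  finiteness. The time is common to all \<open>x\<close>; the exceptional null set may depend on
  \<open>x\<close>.\<close>

lemma kato_class_path_integral_finite:
  fixes X :: "real \<Rightarrow> 'w \<Rightarrow> 'a::euclidean_space"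
  assumes M: "prob_space M" and Y: "(\<lambda>(s, \<omega>). Y s \<omega>) \<in> borel_measurable (lborel \<Otimes>\<^sub>M M)"
    and YX: "AE \<omega> in M. \<forall>s\<ge>0. Y s \<omega> = X s \<omega>" and W: "W \<in> kato_class M X"
  obtains t where "0 < t"
    "\<forall>x. AE \<omega> in M. (\<integral>\<^sup>+s\<in>{0..t}. ennreal \<bar>W (x + Y s \<omega>)\<bar> \<partial>lborel) < \<infinity>"
proof -
  interpret prob_space M by fact
  interpret pair_sigma_finite lborel M ..
  have [measurable]: "W \<in> borel_measurable borel" using W by (simp add: kato_class_def)
  have "((\<lambda>t. SUP x. path_nn_expectation M X x
        (\<lambda>w. \<integral>\<^sup>+s\<in>{0..t}. ennreal \<bar>W (w s)\<bar> \<partial>lborel)) \<longlongrightarrow> 0) (at_right 0)"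
    using W by (simp add: kato_class_def)
  then have "\<forall>\<^sub>F t in at_right 0. (SUP x. path_nn_expectation M X x
        (\<lambda>w. \<integral>\<^sup>+s\<in>{0..t}. ennreal \<bar>W (w s)\<bar> \<partial>lborel)) < 1"
    by (rule order_tendstoD) simp
  moreover have "\<forall>\<^sub>F t in at_right (0::real). 0 < t" by (simp add: eventually_at_filter)
  ultimately have "\<forall>\<^sub>F t in at_right 0. 0 < t \<and> (SUP x. path_nn_expectation M X x
        (\<lambda>w. \<integral>\<^sup>+s\<in>{0..t}. ennreal \<bar>W (w s)\<bar> \<partial>lborel)) < 1"
    by (rule eventually_conj[rotated])
  then obtain t where t: "0 < t" and sup: "(SUP x. path_nn_expectation M X x
        (\<lambda>w. \<integral>\<^sup>+s\<in>{0..t}. ennreal \<bar>W (w s)\<bar> \<partial>lborel)) < 1"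
    using eventually_happens[of _ "at_right (0::real)"] by (auto simp: trivial_limit_at_right_real)
  show ?thesis
  proof (rule that[OF t], rule allI)
    fix x
    let ?G = "\<lambda>\<omega>. \<integral>\<^sup>+s\<in>{0..t}. ennreal \<bar>W (x + Y s \<omega>)\<bar> \<partial>lborel"
    have [measurable]: "?G \<in> borel_measurable M"
    proof -
      have [measurable]: "(\<lambda>p. Y (snd p) (fst p)) \<in> borel_measurable (M \<Otimes>\<^sub>M lborel)"
        using measurable_compose[OF measurable_pair_swap' Y] by (simp add: case_prod_unfold)
      show ?thesis by measurable
    qed
    have "integral\<^sup>N M ?G = integral\<^sup>N (completion M) ?G" by (simp add: nn_integral_completion)
    also have "\<dots> = path_nn_expectation M X x (\<lambda>w. \<integral>\<^sup>+s\<in>{0..t}. ennreal \<bar>W (w s)\<bar> \<partial>lborel)"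
      unfolding path_nn_expectation_def
    proof (rule nn_integral_cong_AE, use AE_completion[OF YX] in eventually_elim)
      fix \<omega> assume "\<forall>s\<ge>0. Y s \<omega> = X s \<omega>"
      then show "?G \<omega> = (\<integral>\<^sup>+s\<in>{0..t}. ennreal \<bar>W (x + X s \<omega>)\<bar> \<partial>lborel)"
        by (intro nn_integral_cong) (auto simp: indicator_def)
    qed
    also have "\<dots> < 1" using sup by (rule le_less_trans[OF SUP_upper[OF UNIV_I]])
    finally have "integral\<^sup>N M ?G \<noteq> \<infinity>" by auto
    then have "AE \<omega> in M. ?G \<omega> \<noteq> \<infinity>" by (intro nn_integral_noteq_infinite) auto
    then show "AE \<omega> in M. ?G \<omega> < \<infinity>" by eventually_elim (simp add: less_top)
  qed
qed

text \<open>Monotonicity requires \<open>V\<close> to be integrable along the path: otherwise the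
  path integral is 0 by convention and the claim fails for negative \<open>K\<close>. Before the
  exit \<open>V\<close> is bounded above by \<open>K\<close>, and \<open>fin\<close> controls its
  negative part.\<close>

lemma exp_path_integral_ge:
  fixes w :: "real \<Rightarrow> 'a::euclidean_space"
  assumes t: "0 < t" "ereal t < exit_time D w" and VK: "\<And>y. y \<in> D \<Longrightarrow> V y \<le> K"
    and meas: "(\<lambda>s. indicator {0..t} s * V (w s)) \<in> borel_measurable lborel"
    and fin: "(\<integral>\<^sup>+s\<in>{0..t}. ennreal \<bar>neg_part V (w s)\<bar> \<partial>lborel) < \<infinity>"
  shows "exp (- K * t) \<le> exp (- (LBINT s:{0..t}. V (w s)))"
proof -
  \<comment> \<open>The strict inequality for the exit time covers the closed interval, endpoint
    included.\<close>
  have D: "w s \<in> D" if "s \<in> {0..t}" for s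
  proof (rule ccontr)
    assume "w s \<notin> D"
    then have "exit_time D w \<le> ereal s" unfolding exit_time_def using that by (intro Inf_lower) auto
    also have "\<dots> \<le> ereal t" using that by simp
    finally show False using t by simp
  qed
  have int: "set_integrable lborel {0..t} (\<lambda>s. V (w s))"
    unfolding set_integrable_def
  proof (rule integrableI_bounded)
    show "(\<lambda>s. indicator {0..t} s *\<^sub>R V (w s)) \<in> borel_measurable lborel" using meas by simp
    have "(\<integral>\<^sup>+s. ennreal (norm (indicator {0..t} s *\<^sub>R V (w s))) \<partial>lborel)
        \<le> (\<integral>\<^sup>+s. ennreal \<bar>neg_part V (w s)\<bar> * indicator {0..t} s + ennreal (max 0 K) * indicator {0..t} s \<partial>lborel)"
    proof (rule nn_integral_mono)
      fix s :: real
      show "ennreal (norm (indicator {0..t} s *\<^sub>R V (w s)))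
          \<le> ennreal \<bar>neg_part V (w s)\<bar> * indicator {0..t} s + ennreal (max 0 K) * indicator {0..t} s"
      proof (cases "s \<in> {0..t}")
        case True
        have "\<bar>V (w s)\<bar> \<le> \<bar>neg_part V (w s)\<bar> + max 0 K"
          using VK[OF D[OF True]] by (auto simp: neg_part_def)
        then have "ennreal \<bar>V (w s)\<bar> \<le> ennreal (\<bar>neg_part V (w s)\<bar> + max 0 K)" by (rule ennreal_leI)
        also have "\<dots> = ennreal \<bar>neg_part V (w s)\<bar> + ennreal (max 0 K)" by (rule ennreal_plus) auto
        finally show ?thesis using True by simp
      qed simp
    qed
    also have "\<dots> = (\<integral>\<^sup>+s. ennreal \<bar>neg_part V (w s)\<bar> * indicator {0..t} s \<partial>lborel)
        + (\<integral>\<^sup>+s. ennreal (max 0 K) * indicator {0..t} s \<partial>lborel)"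
    proof (rule nn_integral_add)
      have "(\<lambda>s. ennreal (neg_part (\<lambda>s. indicator {0..t} s * V (w s)) s)) \<in> borel_measurable lborel"
        using meas unfolding neg_part_def by measurable
      moreover have "ennreal (neg_part (\<lambda>s. indicator {0..t} s * V (w s)) s)
          = ennreal \<bar>neg_part V (w s)\<bar> * indicator {0..t} s" for s
        by (simp add: neg_part_def indicator_def)
      ultimately show "(\<lambda>s. ennreal \<bar>neg_part V (w s)\<bar> * indicator {0..t} s) \<in> borel_measurable lborel" by simp
    qed simp
    also have "(\<integral>\<^sup>+s. ennreal (max 0 K) * indicator {0..t} s \<partial>lborel) < \<infinity>"
      using t by (simp add: nn_integral_cmult_indicator ennreal_mult_less_top)
    finally show "(\<integral>\<^sup>+s. ennreal (norm (indicator {0..t} s *\<^sub>R V (w s))) \<partial>lborel) < \<infinity>"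
      using fin by (simp add: less_top)
  qed
  have "(LBINT s:{0..t}. V (w s)) \<le> (LBINT s:{0..t}. K)"
    using int VK D borel_integrable_atLeastAtMost'[OF continuous_on_const] by (intro set_integral_mono) auto
  also have "\<dots> = K * t" using t by (simp add: set_lebesgue_integral_def)
  finally show ?thesis by simp
qed

section \<open>Comparison of the Feynman-Kac and the killed semigroup\<close>

text \<open>The Feynman-Kac integral is \<open>0\<close> by convention wherever the integrand is not integrable. If this
  happened on a set \<open>B\<close> of positive measure, comparing \<open>T t \<Phi>\<close> with \<open>T t (\<Phi> + 1\<^sub>B)\<close> would give
  \<open>T t 1\<^sub>B = 0\<close> on \<open>B\<close>, which is excluded by the injectivity of \<open>T t\<close>. This replaces exponential moment
  estimates for Kato class potentials.\<close>

lemma feynman_kac_integrable_AE: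
  fixes X :: "real \<Rightarrow> 'w \<Rightarrow> 'a::euclidean_space" and \<phi> :: "'a \<Rightarrow> real"
  assumes H: "schroedinger_semigroup H (feynman_kac M X V)" and M: "prob_space M"
    and X: "X t \<in> borel_measurable M" and t: "0 < t"
    and \<phi>: "(\<lambda>x. complex_of_real (\<phi> x)) \<in> L2 lborel" and \<phi>0: "\<And>x. 0 \<le> \<phi> x"
    and D: "D \<in> sets borel" "emeasure lborel D < \<infinity>"
  shows "AE x in lborel. x \<in> D \<longrightarrow> integrable (completion M)
    (\<lambda>\<omega>. exp (- (LBINT s:{0..t}. V (x + X s \<omega>))) * \<phi> (x + X t \<omega>))"
proof -
  interpret schroedinger_semigroup H "feynman_kac M X V" by fact
  interpret prob_space M by fact
  let ?T = "feynman_kac M X V t"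
  define \<Phi> where "\<Phi> = (\<lambda>x. complex_of_real (\<phi> x))"
  have \<Phi>L: "\<Phi> \<in> L2 lborel" using \<phi> by (simp add: \<Phi>_def)
  have \<phi>m[measurable]: "\<phi> \<in> borel_measurable borel"
  proof -
    have "(\<lambda>x. Re (\<Phi> x)) \<in> borel_measurable borel" using L2_measurable[OF \<Phi>L] by measurable
    then show ?thesis by (simp add: \<Phi>_def)
  qed
  note X[measurable] D(1)[measurable]
  have [measurable]: "X t \<in> borel_measurable (completion M)" by (rule measurable_completion[OF X])
  define E where "E x \<omega> = exp (- (LBINT s:{0..t}. V (x + X s \<omega>)))" for x \<omega>
  have E0: "0 < E x \<omega>" for x \<omega> by (simp add: E_def)
  have Tint: "?T (\<lambda>x. complex_of_real (\<psi> x)) x = of_real (\<integral>\<omega>. E x \<omega> * \<psi> (x + X t \<omega>) \<partial>completion M)" for \<psi> x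
    unfolding feynman_kac_def path_expectation_def E_def by (simp flip: of_real_mult)
  \<comment> \<open>The exceptional set, described so that it is visibly measurable;
    \<open>not_int\<close> and \<open>in_B\<close> identify it with the points of \<open>D\<close>
    at which the integrand is not integrable.\<close>
  define B where "B = {x \<in> D. ?T \<Phi> x = 0 \<and> (\<integral>\<^sup>+\<omega>. ennreal (\<phi> (x + X t \<omega>)) \<partial>M) \<noteq> 0}"
  have "?T \<Phi> \<in> borel_measurable lborel" by (rule L2_measurable[OF T_L2[OF less_imp_le[OF t] \<Phi>L]])
  then have Tm[measurable]: "?T \<Phi> \<in> borel_measurable borel" by simp
  have [measurable]: "B \<in> sets borel"
  proof -
    have "Measurable.pred borel (\<lambda>x. x \<in> D \<and> ?T \<Phi> x = 0 \<and> (\<integral>\<^sup>+\<omega>. ennreal (\<phi> (x + X t \<omega>)) \<partial>M) \<noteq> 0)"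
      by measurable
    then show ?thesis unfolding B_def pred_def by simp
  qed
  have not_int: "\<not> integrable (completion M) (\<lambda>\<omega>. E x \<omega> * \<phi> (x + X t \<omega>))" if "x \<in> B" for x
  proof
    assume i: "integrable (completion M) (\<lambda>\<omega>. E x \<omega> * \<phi> (x + X t \<omega>))"
    have "(\<integral>\<omega>. E x \<omega> * \<phi> (x + X t \<omega>) \<partial>completion M) = 0"
      using that Tint[of \<phi> x] by (simp add: B_def \<Phi>_def)
    then have "AE \<omega> in completion M. E x \<omega> * \<phi> (x + X t \<omega>) = 0"
      by (subst (asm) integral_nonneg_eq_0_iff_AE[OF i]) (use E0 \<phi>0 in \<open>auto simp: less_imp_le\<close>)
    then have "AE \<omega> in completion M. ennreal (\<phi> (x + X t \<omega>)) = 0"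
      by eventually_elim (use E0 in \<open>auto simp: less_imp_neq[THEN not_sym]\<close>)
    then have "(\<integral>\<^sup>+\<omega>. ennreal (\<phi> (x + X t \<omega>)) \<partial>completion M) = (\<integral>\<^sup>+\<omega>. 0 \<partial>completion M)"
      by (rule nn_integral_cong_AE)
    then have "(\<integral>\<^sup>+\<omega>. ennreal (\<phi> (x + X t \<omega>)) \<partial>M) = 0" by (simp add: nn_integral_completion)
    then show False using that by (simp add: B_def)
  qed
  have in_B: "x \<in> B" if "x \<in> D" and ni: "\<not> integrable (completion M) (\<lambda>\<omega>. E x \<omega> * \<phi> (x + X t \<omega>))" for x
  proof -
    have "?T \<Phi> x = 0" using Tint[of \<phi> x] not_integrable_integral_eq[OF ni] by (simp add: \<Phi>_def)
    moreover have False if "(\<integral>\<^sup>+\<omega>. ennreal (\<phi> (x + X t \<omega>)) \<partial>M) = 0"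
    proof -
      have "AE \<omega> in M. \<phi> (x + X t \<omega>) = 0"
        using that \<phi>0 by (subst (asm) nn_integral_0_iff_AE) (auto elim: eventually_mono simp: antisym)
      then have ae: "AE \<omega> in completion M. E x \<omega> * \<phi> (x + X t \<omega>) = 0"
        by (intro AE_completion) (auto elim: eventually_mono)
      \<comment> \<open>No measurability of \<open>E x\<close> is at hand, but the product vanishes
        almost surely, which suffices in the completed space.\<close>
      have m: "(\<lambda>\<omega>. E x \<omega> * \<phi> (x + X t \<omega>)) \<in> borel_measurable (completion M)"
        by (rule completion.measurable_cong_AE_complete[OF _ ae]) auto
      have "integrable (completion M) (\<lambda>\<omega>. E x \<omega> * \<phi> (x + X t \<omega>))
          \<longleftrightarrow> integrable (completion M) (\<lambda>\<omega>. 0 :: real)"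
        by (rule integrable_cong_AE[OF m _ ae]) simp
      then show False using ni by simp
    qed
    ultimately show ?thesis using \<open>x \<in> D\<close> by (auto simp: B_def)
  qed
  define I where "I = (\<lambda>x. complex_of_real (indicator B x))"
  have IL: "I \<in> L2 lborel"
  proof -
    have "emeasure lborel B < \<infinity>"
      using emeasure_mono[of B D lborel] D by (auto simp: B_def intro: le_less_trans)
    then have "integrable lborel (indicator B :: 'a \<Rightarrow> real)" by (simp add: integrable_indicator_iff)
    moreover have "(cmod (I x))\<^sup>2 = indicator B x" for x by (simp add: I_def indicator_def)
    ultimately show ?thesis unfolding L2_def by (auto simp: I_def)
  qed
  \<comment> \<open>Adding a nonnegative indicator cannot restore integrability, so the integral
    takes its default value 0 again.\<close>
  have zero: "?T (\<lambda>y. \<Phi> y + I y) x = 0" if x: "x \<in> B" for x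
  proof -
    have "\<not> integrable (completion M) (\<lambda>\<omega>. E x \<omega> * (\<phi> (x + X t \<omega>) + indicator B (x + X t \<omega>)))"
    proof
      assume i: "integrable (completion M) (\<lambda>\<omega>. E x \<omega> * (\<phi> (x + X t \<omega>) + indicator B (x + X t \<omega>)))"
      \<comment> \<open>Multiplying the integrable product by
        \<open>\<rho> (x + X t \<omega>)\<close> recovers the integrand for \<open>\<phi>\<close> in
        measurable form without separating off \<open>E x\<close>. Where the denominator is 0, so is
        \<open>\<phi>\<close>, and the default quotient 0 fits.\<close>
      define \<rho> where "\<rho> y = \<phi> y / (\<phi> y + indicator B y)" for y
      have [measurable]: "\<rho> \<in> borel_measurable borel" unfolding \<rho>_def by measurable
      have eq: "\<phi> y = (\<phi> y + indicator B y) * \<rho> y" for y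
        using \<phi>0[of y] by (auto simp: \<rho>_def indicator_def)
      have "integrable (completion M) (\<lambda>\<omega>. E x \<omega> * \<phi> (x + X t \<omega>))"
      proof (rule Bochner_Integration.integrable_bound[OF i])
        have "(\<lambda>\<omega>. (E x \<omega> * (\<phi> (x + X t \<omega>) + indicator B (x + X t \<omega>))) * \<rho> (x + X t \<omega>))
            \<in> borel_measurable (completion M)"
          using borel_measurable_integrable[OF i] by measurable
        then show "(\<lambda>\<omega>. E x \<omega> * \<phi> (x + X t \<omega>)) \<in> borel_measurable (completion M)"
          by (simp add: mult.assoc flip: eq)
        show "AE \<omega> in completion M. norm (E x \<omega> * \<phi> (x + X t \<omega>))
            \<le> norm (E x \<omega> * (\<phi> (x + X t \<omega>) + indicator B (x + X t \<omega>)))"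
          using \<phi>0 E0 by (intro AE_I2) (auto simp: abs_mult less_imp_le intro!: mult_left_mono)
      qed
      then show False using not_int[OF x] by simp
    qed
    then show ?thesis
      using Tint[of "\<lambda>y. \<phi> y + indicator B y" x] by (simp add: \<Phi>_def I_def not_integrable_integral_eq)
  qed
  have "AE x in lborel. ?T (\<lambda>y. \<Phi> y + I y) x = ?T \<Phi> x + ?T I x"
    using T_add[OF _ \<Phi>L IL] t by simp
  \<comment> \<open>On \<open>B\<close> both \<open>?T \<Phi>\<close> and the image of the sum are
    0, hence so is \<open>?T I\<close>; off \<open>B\<close> the factor \<open>I\<close>
    vanishes.\<close>
  then have "AE x in lborel. ?T I x * cnj (I x) = 0"
  proof eventually_elim
    fix x assume "?T (\<lambda>y. \<Phi> y + I y) x = ?T \<Phi> x + ?T I x"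
    then show "?T I x * cnj (I x) = 0"
      using zero[of x] by (cases "x \<in> B") (auto simp: I_def B_def)
  qed
  then have "L2_inner lborel (?T I) I = 0"
    unfolding L2_inner_def by (rule integral_eq_zero_AE)
  then have "AE x in lborel. I x = 0" using t IL by (intro form_eq_zero_AE[of t]) auto
  then show ?thesis
  proof eventually_elim
    fix x assume "I x = 0"
    then have "x \<notin> B" by (simp add: I_def indicator_eq_0_iff)
    then show "x \<in> D \<longrightarrow> integrable (completion M)
        (\<lambda>\<omega>. exp (- (LBINT s:{0..t}. V (x + X s \<omega>))) * \<phi> (x + X t \<omega>))"
      using in_B[of x] unfolding E_def by blast
  qed
qed

text \<open>The eigenfunction is complex valued, hence the modulus: the triangle inequality turns
  the eigenvalue equation into a lower bound. Paths that have left \<open>D\<close> contribute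
  nonnegatively to the Feynman-Kac expectation and can be discarded.\<close>

lemma feynman_kac_killed_comparison:
  fixes X :: "real \<Rightarrow> 'w \<Rightarrow> 'a::euclidean_space"
  assumes H: "schroedinger_semigroup H (feynman_kac M X V)" and gs: "ground_state_exists_at lborel H E0"
    and M: "prob_space M" and X: "\<And>t. 0 \<le> t \<Longrightarrow> X t \<in> borel_measurable M"
    and cad: "AE \<omega> in M. cadlag (\<lambda>t. X t \<omega>)"
    and V: "V \<in> borel_measurable borel" "neg_part V \<in> kato_class M X"
    and D: "D \<in> sets borel" "emeasure lborel D < \<infinity>"
    and VK: "\<And>y. y \<in> D \<Longrightarrow> V y \<le> K"
    and \<mu>: "principal_eigenvalue M X D \<mu>"
  shows "E0 \<le> K + \<mu>"
proof -
  interpret schroedinger_semigroup H "feynman_kac M X V" by fact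
  interpret prob_space M by fact
  note V(1)[measurable] D(1)[measurable]
  obtain Y where Ym: "(\<lambda>(s, \<omega>). Y s \<omega>) \<in> borel_measurable (lborel \<Otimes>\<^sub>M M)"
    and YX: "AE \<omega> in M. \<forall>s\<ge>0. Y s \<omega> = X s \<omega>"
    by (rule cadlag_jointly_measurable_version[OF X cad])
  obtain t where t: "0 < t"
    and fin: "\<forall>x. AE \<omega> in M. (\<integral>\<^sup>+s\<in>{0..t}. ennreal \<bar>neg_part V (x + Y s \<omega>)\<bar> \<partial>lborel) < \<infinity>"
    by (rule kato_class_path_integral_finite[OF M Ym YX V(2)])
  let ?T = "feynman_kac M X V t"
  define E where "E x \<omega> = exp (- (LBINT s:{0..t}. V (x + X s \<omega>)))" for x \<omega>
  have path: "AE \<omega> in completion M. ereal t < exit_time D (\<lambda>s. x + X s \<omega>) \<longrightarrow> exp (- K * t) \<le> E x \<omega>" for x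
  proof -
    have "AE \<omega> in M. ereal t < exit_time D (\<lambda>s. x + X s \<omega>) \<longrightarrow> exp (- K * t) \<le> E x \<omega>"
      using YX spec[OF fin, of x] AE_space
    proof eventually_elim
      case (elim \<omega>)
      \<comment> \<open>Measurability in time is obtained for the version \<open>Y\<close> and
        transferred to \<open>X\<close>, with which it agrees at nonnegative times.\<close>
      have [measurable]: "(\<lambda>s. Y s \<omega>) \<in> borel_measurable lborel"
        using measurable_compose[OF measurable_Pair2'[OF elim(3)] Ym] by simp
      have "(\<lambda>s. indicator {0..t} s * V (x + Y s \<omega>)) \<in> borel_measurable lborel" by measurable
      moreover have "indicator {0..t} s * V (x + Y s \<omega>) = indicator {0..t} s * V (x + X s \<omega>)" for s
        using elim(1) by (simp add: indicator_def)
      ultimately have m: "(\<lambda>s. indicator {0..t} s * V (x + X s \<omega>)) \<in> borel_measurable lborel" by simp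
      have eq: "(\<integral>\<^sup>+s\<in>{0..t}. ennreal \<bar>neg_part V (x + Y s \<omega>)\<bar> \<partial>lborel)
          = (\<integral>\<^sup>+s\<in>{0..t}. ennreal \<bar>neg_part V (x + X s \<omega>)\<bar> \<partial>lborel)"
        using elim(1) by (intro nn_integral_cong) (auto simp: indicator_def)
      show ?case
        unfolding E_def
        using exp_path_integral_ge[where w = "\<lambda>s. x + X s \<omega>", OF t _ VK m] elim(2)[unfolded eq] by blast
    qed
    then show ?thesis by (rule AE_completion)
  qed
  obtain f g where f: "f \<in> L2 (restrict_space lborel D)"
    and Pf: "AE x in restrict_space lborel D. g x = killed_semigroup M X D t f x"
    and f0: "\<not> (AE x in restrict_space lborel D. f x = 0)"
    and gf: "AE x in restrict_space lborel D. g x = of_real (exp (- \<mu> * t)) * f x"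
    using \<mu> t unfolding principal_eigenvalue_def eigenvalue_def operator_graph_def Let_def by auto
  have "AE x in restrict_space lborel D. killed_semigroup M X D t f x = of_real (exp (- \<mu> * t)) * f x"
    using Pf gf by eventually_elim simp
  then have eig: "AE x in lborel. x \<in> D \<longrightarrow> killed_semigroup M X D t f x = of_real (exp (- \<mu> * t)) * f x"
    by (subst (asm) AE_restrict_space_iff) auto
  define \<phi> where "\<phi> x = indicator D x * cmod (f x)" for x
  define \<Phi> where "\<Phi> = (\<lambda>x. complex_of_real (\<phi> x))"
  have \<phi>0: "0 \<le> \<phi> x" for x by (simp add: \<phi>_def)
  have sq: "(cmod (\<Phi> x))\<^sup>2 = (\<phi> x)\<^sup>2" for x by (simp add: \<Phi>_def)
  have \<phi>int: "integrable lborel (\<lambda>x. (\<phi> x)\<^sup>2)"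
  proof -
    have "integrable (restrict_space lborel D) (\<lambda>x. (cmod (f x))\<^sup>2)" using f by (simp add: L2_def)
    then have "integrable lborel (\<lambda>x. indicator D x *\<^sub>R (cmod (f x))\<^sup>2)"
      by (subst (asm) integrable_restrict_space) auto
    moreover have "indicator D x *\<^sub>R (cmod (f x))\<^sup>2 = (\<phi> x)\<^sup>2" for x by (simp add: \<phi>_def indicator_def)
    ultimately show ?thesis by simp
  qed
  have \<phi>m[measurable]: "\<phi> \<in> borel_measurable borel"
  proof -
    have "(\<lambda>x. cmod (f x)) \<in> borel_measurable (restrict_space lborel D)"
      using L2_measurable[OF f] by measurable
    then have "(\<lambda>x. indicator D x *\<^sub>R cmod (f x)) \<in> borel_measurable lborel"
      by (subst (asm) borel_measurable_restrict_space_iff) auto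
    then show ?thesis by (simp add: \<phi>_def[abs_def])
  qed
  have \<Phi>L: "\<Phi> \<in> L2 lborel" using \<phi>int unfolding L2_def sq by (simp add: \<Phi>_def)
  have int: "AE x in lborel. x \<in> D \<longrightarrow> integrable (completion M) (\<lambda>\<omega>. E x \<omega> * \<phi> (x + X t \<omega>))"
    unfolding E_def using t \<Phi>L \<phi>0 D
    by (intro feynman_kac_integrable_AE[OF H M X]) (auto simp: \<Phi>_def)
  have Tint: "?T \<Phi> x = of_real (\<integral>\<omega>. E x \<omega> * \<phi> (x + X t \<omega>) \<partial>completion M)" for x
    unfolding feynman_kac_def path_expectation_def E_def \<Phi>_def by (simp flip: of_real_mult)
  have key: "AE x in lborel. exp (- (K + \<mu>) * t) * (\<phi> x)\<^sup>2 \<le> Re (?T \<Phi> x * cnj (\<Phi> x))"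
    using eig int
  proof eventually_elim
    case (elim x)
    show ?case
    \<comment> \<open>In the other case \<open>\<phi> x = 0\<close>, so both sides vanish.\<close>
    proof (cases "x \<in> D \<and> f x \<noteq> 0")
      case True
      define q where "q \<omega> = (if ereal t < exit_time D (\<lambda>s. x + X s \<omega>) then f (x + X t \<omega>) else 0)" for \<omega>
      have q: "(\<integral>\<omega>. q \<omega> \<partial>completion M) = of_real (exp (- \<mu> * t)) * f x"
        using elim(1) True unfolding killed_semigroup_def path_expectation_def q_def by simp
      \<comment> \<open>A non-integrable function has integral 0, whereas the right-hand side of the
        eigenvalue equation is nonzero here.\<close>
      then have qi: "integrable (completion M) q"
        using not_integrable_integral_eq[of "completion M" q] True by auto
      have "AE \<omega> in completion M. exp (- K * t) * cmod (q \<omega>) \<le> E x \<omega> * \<phi> (x + X t \<omega>)"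
        using path[of x]
      proof eventually_elim
        case (elim \<omega>)
        show ?case
        proof (cases "ereal t < exit_time D (\<lambda>s. x + X s \<omega>)")
          case True
          have "x + X t \<omega> \<in> D"
          proof (rule ccontr)
            assume "x + X t \<omega> \<notin> D"
            then have "exit_time D (\<lambda>s. x + X s \<omega>) \<le> ereal t"
              unfolding exit_time_def using t by (intro Inf_lower) auto
            then show False using True by simp
          qed
          then show ?thesis using elim True by (simp add: q_def \<phi>_def mult_right_mono)
        qed (simp add: q_def E_def \<phi>0)
      qed
      then have "(\<integral>\<omega>. exp (- K * t) * cmod (q \<omega>) \<partial>completion M) \<le> (\<integral>\<omega>. E x \<omega> * \<phi> (x + X t \<omega>) \<partial>completion M)"
        using qi elim(2) True by (intro integral_mono_AE) auto
      then have "exp (- K * t) * (\<integral>\<omega>. cmod (q \<omega>) \<partial>completion M) \<le> Re (?T \<Phi> x)" by (simp add: Tint)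
      moreover have "cmod (\<integral>\<omega>. q \<omega> \<partial>completion M) \<le> (\<integral>\<omega>. cmod (q \<omega>) \<partial>completion M)" by (rule integral_norm_bound)
      then have "exp (- \<mu> * t) * \<phi> x \<le> (\<integral>\<omega>. cmod (q \<omega>) \<partial>completion M)"
        unfolding q using True by (simp add: norm_mult \<phi>_def)
      then have "exp (- K * t) * (exp (- \<mu> * t) * \<phi> x) \<le> exp (- K * t) * (\<integral>\<omega>. cmod (q \<omega>) \<partial>completion M)"
        by (rule mult_left_mono) simp
      moreover have "exp (- (K + \<mu>) * t) = exp (- K * t) * exp (- \<mu> * t)"
        unfolding exp_add[symmetric] by (simp add: algebra_simps)
      ultimately have "exp (- (K + \<mu>) * t) * \<phi> x \<le> Re (?T \<Phi> x)" by (simp only: mult.assoc)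
      from mult_right_mono[OF this \<phi>0[of x]] show ?thesis
        by (simp add: \<Phi>_def power2_eq_square mult.assoc)
    qed (auto simp: \<phi>_def \<Phi>_def)
  qed
  have "exp (- (K + \<mu>) * t) * (\<integral>x. (\<phi> x)\<^sup>2 \<partial>lborel) = (\<integral>x. exp (- (K + \<mu>) * t) * (\<phi> x)\<^sup>2 \<partial>lborel)" by simp
  also have "\<dots> \<le> (\<integral>x. Re (?T \<Phi> x * cnj (\<Phi> x)) \<partial>lborel)"
    using key \<phi>int integrable_L2_mult[OF T_L2[of t, OF _ \<Phi>L] \<Phi>L] t
    by (intro integral_mono_AE integrable_mult_right integrable_Re) auto
  also have "\<dots> = Re (L2_inner lborel (?T \<Phi>) \<Phi>)"
    unfolding L2_inner_def using integrable_L2_mult[OF T_L2[of t, OF _ \<Phi>L] \<Phi>L] t by (intro integral_Re) auto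
  also have "\<dots> \<le> exp (- E0 * t) * (\<integral>x. (\<phi> x)\<^sup>2 \<partial>lborel)"
    using form_le[OF gs t \<Phi>L] by (simp add: sq)
  finally have le: "exp (- (K + \<mu>) * t) * (\<integral>x. (\<phi> x)\<^sup>2 \<partial>lborel) \<le> exp (- E0 * t) * (\<integral>x. (\<phi> x)\<^sup>2 \<partial>lborel)" .
  have "(\<integral>x. (\<phi> x)\<^sup>2 \<partial>lborel) \<noteq> 0"
  proof
    assume "(\<integral>x. (\<phi> x)\<^sup>2 \<partial>lborel) = 0"
    then have "AE x in lborel. (\<phi> x)\<^sup>2 = 0"
      by (subst (asm) integral_nonneg_eq_0_iff_AE[OF \<phi>int]) auto
    then have "AE x in lborel. x \<in> D \<longrightarrow> f x = 0" by eventually_elim (auto simp: \<phi>_def)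
    then have "AE x in restrict_space lborel D. f x = 0" by (subst AE_restrict_space_iff) auto
    then show False using f0 by simp
  qed
  then have "0 < (\<integral>x. (\<phi> x)\<^sup>2 \<partial>lborel)" by (simp add: less_le integral_nonneg)
  then have "E0 * t \<le> (K + \<mu>) * t" using le by (simp add: algebra_simps)
  then show ?thesis using t by simp
qed

section \<open>Supremum and infimum over the closed ball\<close>

theorem proposition4p3:
  fixes M :: "'w measure"
    and X :: "real \<Rightarrow> 'w \<Rightarrow> real ^ 'n"
    and A :: "real ^ 'n ^ 'n"
    and \<nu> :: "real ^ 'n \<Rightarrow> real"
    and V :: "real ^ 'n \<Rightarrow> real"
    and H :: "(real ^ 'n \<Rightarrow> complex) rel"
    and E0 :: real
    and \<mu> :: "real \<Rightarrow> real"
  assumes "symmetric_levy_process M X"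
    and "transpose A = A" and "\<And>\<xi>. 0 \<le> (A *v \<xi>) \<bullet> \<xi>"
    and "\<nu> \<in> borel_measurable borel" and "\<And>z. z \<noteq> 0 \<Longrightarrow> 0 < \<nu> z"
    and "symmetric_levy_measure (density lborel (\<lambda>z. ennreal (\<nu> z)))"
    and "emeasure (density lborel (\<lambda>z. ennreal (\<nu> z))) (- {0}) = \<infinity>"
    and "has_exponent M X (levy_exponent A (density lborel (\<lambda>z. ennreal (\<nu> z))))"
    and "kato_decomposable M X V"
    and "(V \<longlongrightarrow> 0) at_infinity"
    and "schroedinger_operator M X V H"
    and "ground_state_exists_at lborel H E0"
    and "E0 < 0"
    and "\<And>r. 0 < r \<Longrightarrow> 0 < \<mu> r \<and> principal_eigenvalue M X (ball 0 r) (\<mu> r)"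
  shows "\<forall>r>0. ereal E0 \<le>
    (SUP y\<in>cball 0 (2 * r). ereal (pos_part V y)) - (INF y\<in>cball 0 (2 * r). ereal (neg_part V y))
      + ereal (\<mu> r)"
proof (intro allI impI)
  fix r :: real assume r: "0 < r"
  let ?S = "SUP y\<in>cball 0 (2 * r). ereal (pos_part V y)"
  let ?I = "INF y\<in>cball 0 (2 * r). ereal (neg_part V y)"
  have "0 \<in> cball (0 :: real ^ 'n) (2 * r)" using r by simp
  then have I: "?I \<le> ereal (neg_part V 0)" and S0: "ereal (pos_part V 0) \<le> ?S"
    by (intro INF_lower SUP_upper; assumption)+
  have "0 \<le> neg_part V y" for y by (simp add: neg_part_def)
  then have I0: "0 \<le> ?I" by (intro INF_greatest) simp
  \<comment> \<open>The infimum lies between 0 and its value at the origin, so the extended-real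
    difference is never of the form infinity minus infinity.\<close>
  obtain i where i: "?I = ereal i" using I I0 by (cases ?I) auto
  show "ereal E0 \<le> ?S - ?I + ereal (\<mu> r)"
  \<comment> \<open>An infinite supremum makes the right-hand side infinite; \<open>S0\<close>
    excludes minus infinity.\<close>
  proof (cases ?S)
    case (real s)
    have "E0 \<le> (s - i) + \<mu> r"
    proof (rule feynman_kac_killed_comparison[where D = "ball 0 r"])
      show "schroedinger_semigroup H (feynman_kac M X V)"
        using assms(11) by (simp add: schroedinger_semigroup_def schroedinger_operator_def)
      \<comment> \<open>The open ball of radius \<open>r\<close> lies in the closed ball of radius
        \<open>2 * r\<close>, where the two parts of \<open>V\<close> are bounded
        separately.\<close>
      show "V y \<le> s - i" if "y \<in> ball 0 r" for y
      proof -
        have y: "y \<in> cball 0 (2 * r)" using that r by simp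
        have "ereal (pos_part V y) \<le> ereal s" unfolding real[symmetric] using y by (rule SUP_upper)
        moreover have "ereal i \<le> ereal (neg_part V y)" unfolding i[symmetric] using y by (rule INF_lower)
        moreover have "V y = pos_part V y - neg_part V y" by (simp add: pos_part_def neg_part_def)
        ultimately show ?thesis by simp
      qed
      show "principal_eigenvalue M X (ball 0 r) (\<mu> r)" using assms(14) r by blast
      show "emeasure lborel (ball (0 :: real ^ 'n) r) < \<infinity>"
        using emeasure_bounded_finite[OF bounded_ball] by simp
    qed (use assms in \<open>auto simp: symmetric_levy_process_def levy_process_def kato_decomposable_def\<close>)
    then show ?thesis by (simp add: real i)
  qed (use i S0 in auto)
qed

end
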